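(* Let $\beta>2$. An antitree with $\kappa_+(r)\sim r^\beta$ satisfies $V(r)\sim r^{\beta+1}$ with $$\lambda_0(\Delta)>0\quad\text{and}\quad\sigma(\Delta)=\sigma_{\mathrm{disc}}(\Delta).$$
   Context: Consider an unweighted graph: a countably infinite vertex set $V$ with a symmetric map $b:V\times V\to\{0,1\}$ with zero diagonal ($x\sim y$ iff $b(x,y)=1$), connected and locally finite (each vertex has only finitely many neighbors), with measure $m\equiv1$ and no potential. Let $d$ be the combinatorial graph metric. For a vertex $x_0$ and $r\in\mathbb{N}_0=\{0,1,2,\dots\}$ put $S_r=\{x:d(x,x_0)=r\}$, $S_{-1}=\emptyset$, $B_r=\bigcup_{i=0}^rS_i$. For $x\in S_r$ let $\kappa_\pm(x)$ be the number of neighbors of $x$ in $S_{r\pm1}$. The graph is weakly spherically symmetric with root $x_0$ if $\kappa_+$ and $\kappa_-$ depend only on $d(\cdot,x_0)$; values on $S_r$ are written $\kappa_\pm(r)$. An antitree is such a weakly spherically symmetric unweighted graph with $m\equiv1$ and $\kappa_+(r)=|S_{r+1}|$ for all $r\in\mathbb{N}_0$. Put $V(r)=|B_r|$. For functions $f,g$ on $\mathbb{N}_0$, $f\sim g$ means there are constants $c,C>0$ with $c\,g(r)\le f(r)\le C\,g(r)$ for all $r\ge1$. The graph Laplacian $\Delta$ on $\ell^2(V)$ is the non-negative selfadjoint operator associated to the closure of the form $\frac12\sum_{x,y}b(x,y)(f(x)-f(y))(g(x)-g(y))$ defined on finitely supported functions (the Friedrichs extension); it acts by $\Delta f(x)=\sum_{y\sim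 x}(f(x)-f(y))$. $\sigma(\Delta)$ is its spectrum, $\lambda_0(\Delta)=\inf\sigma(\Delta)$, and $\sigma_{\mathrm{disc}}(\Delta)$ is the set of isolated eigenvalues of finite multiplicity. *)

theory Defs
  imports "HOL-Analysis.Analysis"
begin

text \<open>Graphs have the whole type \<open>'v\<close> as vertex set; \<open>x\<close> and \<open>y\<close> are adjacent iff \<open>b x y = 1\<close>.\<close>

definition unweighted_graph :: "('v \<Rightarrow> 'v \<Rightarrow> real) \<Rightarrow> bool" where
  "unweighted_graph b \<longleftrightarrow>
     countable (UNIV :: 'v set) \<and> infinite (UNIV :: 'v set) \<and>
     (\<forall>x y. b x y \<in> {0, 1}) \<and>
     (\<forall>x y. b x y = b y x) \<and>
     (\<forall>x. b x x = 0) \<and>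
     (\<forall>x y. (\<lambda>u v. b u v = 1)\<^sup>*\<^sup>* x y) \<and>
     (\<forall>x. finite {y. b x y = 1})"

definition graph_dist :: "('v \<Rightarrow> 'v \<Rightarrow> real) \<Rightarrow> 'v \<Rightarrow> 'v \<Rightarrow> nat" where
  "graph_dist b x y = (LEAST n. ((\<lambda>u v. b u v = 1) ^^ n) x y)"

definition graph_sphere :: "('v \<Rightarrow> 'v \<Rightarrow> real) \<Rightarrow> 'v \<Rightarrow> nat \<Rightarrow> 'v set" where
  "graph_sphere b x0 r = {x. graph_dist b x x0 = r}"

definition graph_ball :: "('v \<Rightarrow> 'v \<Rightarrow> real) \<Rightarrow> 'v \<Rightarrow> nat \<Rightarrow> 'v set" where
  "graph_ball b x0 r = (\<Union>i\<le>r. graph_sphere b x0 i)"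

definition graph_volume :: "('v \<Rightarrow> 'v \<Rightarrow> real) \<Rightarrow> 'v \<Rightarrow> nat \<Rightarrow> nat" where
  "graph_volume b x0 r = card (graph_ball b x0 r)"

definition kappa_plus :: "('v \<Rightarrow> 'v \<Rightarrow> real) \<Rightarrow> 'v \<Rightarrow> 'v \<Rightarrow> nat" where
  "kappa_plus b x0 x = card {y. b x y = 1 \<and> graph_dist b y x0 = Suc (graph_dist b x x0)}"

text \<open>Placing the successor on the side of \<open>y\<close> avoids truncated subtraction: the value at the
  root is \<open>0\<close>, in accordance with \<open>S\<^sub>-\<^sub>1 = {}\<close>.\<close>

definition kappa_minus :: "('v \<Rightarrow> 'v \<Rightarrow> real) \<Rightarrow> 'v \<Rightarrow> 'v \<Rightarrow> nat" where
  "kappa_minus b x0 x = card {y. b x y = 1 \<and> Suc (graph_dist b y x0) = graph_dist b x x0}"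

definition weakly_spherically_symmetric :: "('v \<Rightarrow> 'v \<Rightarrow> real) \<Rightarrow> 'v \<Rightarrow> bool" where
  "weakly_spherically_symmetric b x0 \<longleftrightarrow>
     (\<forall>x y. graph_dist b x x0 = graph_dist b y x0 \<longrightarrow>
        kappa_plus b x0 x = kappa_plus b x0 y \<and> kappa_minus b x0 x = kappa_minus b x0 y)"

text \<open>The common value of \<open>kappa_plus\<close> on the sphere of radius \<open>r\<close>. In an infinite, connected,
  locally finite graph every sphere is nonempty, so this is well defined under weak spherical
  symmetry.\<close>

definition kappa_plus_radial :: "('v \<Rightarrow> 'v \<Rightarrow> real) \<Rightarrow> 'v \<Rightarrow> nat \<Rightarrow> nat" where
  "kappa_plus_radial b x0 r = (THE k. \<forall>x\<in>graph_sphere b x0 r. kappa_plus b x0 x = k)"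

definition antitree :: "('v \<Rightarrow> 'v \<Rightarrow> real) \<Rightarrow> 'v \<Rightarrow> bool" where
  "antitree b x0 \<longleftrightarrow> unweighted_graph b \<and> weakly_spherically_symmetric b x0 \<and>
     (\<forall>r. kappa_plus_radial b x0 r = card (graph_sphere b x0 (Suc r)))"

definition comparable :: "(nat \<Rightarrow> real) \<Rightarrow> (nat \<Rightarrow> real) \<Rightarrow> bool" where
  "comparable f g \<longleftrightarrow> (\<exists>c>0. \<exists>C>0. \<forall>r\<ge>1. c * g r \<le> f r \<and> f r \<le> C * g r)"


text \<open>The complex Hilbert space of square summable functions for the counting measure.\<close>

definition l2 :: "('v \<Rightarrow> complex) set" where
  "l2 = {f. (\<lambda>x. (cmod (f x))\<^sup>2) summable_on UNIV}"

definition l2_inner :: "('v \<Rightarrow> complex) \<Rightarrow> ('v \<Rightarrow> complex) \<Rightarrow> complex" where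
  "l2_inner f g = (\<Sum>\<^sub>\<infinity>x. f x * cnj (g x))"

definition l2_norm :: "('v \<Rightarrow> complex) \<Rightarrow> real" where
  "l2_norm f = sqrt (\<Sum>\<^sub>\<infinity>x. (cmod (f x))\<^sup>2)"


text \<open>Closure of a non-negative, closable sesquilinear form \<open>s\<close> with domain \<open>D\<close>: the closure is
  defined on the \<open>l2\<close>-limits of sequences in \<open>D\<close> that are Cauchy with respect to \<open>s\<close>, and its
  values are the limits of the values of \<open>s\<close> along such sequences.\<close>

definition form_approx ::
  "('v \<Rightarrow> complex) set \<Rightarrow> (('v \<Rightarrow> complex) \<Rightarrow> ('v \<Rightarrow> complex) \<Rightarrow> complex) \<Rightarrow>
   (nat \<Rightarrow> 'v \<Rightarrow> complex) \<Rightarrow> ('v \<Rightarrow> complex) \<Rightarrow> bool" where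
  "form_approx D s \<phi> f \<longleftrightarrow>
     f \<in> l2 \<and> (\<forall>n. \<phi> n \<in> D) \<and>
     (\<lambda>n. l2_norm (\<lambda>x. \<phi> n x - f x)) \<longlonglongrightarrow> 0 \<and>
     (\<forall>e>0. \<exists>N. \<forall>m\<ge>N. \<forall>n\<ge>N.
        cmod (s (\<lambda>x. \<phi> m x - \<phi> n x) (\<lambda>x. \<phi> m x - \<phi> n x)) < e)"

definition form_closure_dom ::
  "('v \<Rightarrow> complex) set \<Rightarrow> (('v \<Rightarrow> complex) \<Rightarrow> ('v \<Rightarrow> complex) \<Rightarrow> complex) \<Rightarrow>
   ('v \<Rightarrow> complex) set" where
  "form_closure_dom D s = {f. \<exists>\<phi>. form_approx D s \<phi> f}"

definition form_closure ::
  "('v \<Rightarrow> complex) set \<Rightarrow> (('v \<Rightarrow> complex) \<Rightarrow> ('v \<Rightarrow> complex) \<Rightarrow> complex) \<Rightarrow>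
   ('v \<Rightarrow> complex) \<Rightarrow> ('v \<Rightarrow> complex) \<Rightarrow> complex" where
  "form_closure D s f g =
     (THE z. \<forall>\<phi> \<psi>. form_approx D s \<phi> f \<longrightarrow> form_approx D s \<psi> g \<longrightarrow>
        (\<lambda>n. s (\<phi> n) (\<psi> n)) \<longlonglongrightarrow> z)"

text \<open>The selfadjoint operator associated to a densely defined closed form \<open>q\<close> with domain \<open>D\<close>:
  \<open>f\<close> is mapped to the unique \<open>h\<close> that represents \<open>q f\<close> on \<open>D\<close>.\<close>

definition form_operator_dom ::
  "('v \<Rightarrow> complex) set \<Rightarrow> (('v \<Rightarrow> complex) \<Rightarrow> ('v \<Rightarrow> complex) \<Rightarrow> complex) \<Rightarrow>
   ('v \<Rightarrow> complex) set" where
  "form_operator_dom D q = {f \<in> D. \<exists>h\<in>l2. \<forall>g\<in>D. q f g = l2_inner h g}"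

definition form_operator ::
  "('v \<Rightarrow> complex) set \<Rightarrow> (('v \<Rightarrow> complex) \<Rightarrow> ('v \<Rightarrow> complex) \<Rightarrow> complex) \<Rightarrow>
   ('v \<Rightarrow> complex) \<Rightarrow> ('v \<Rightarrow> complex)" where
  "form_operator D q f = (THE h. h \<in> l2 \<and> (\<forall>g\<in>D. q f g = l2_inner h g))"


definition l2_resolvent_set ::
  "('v \<Rightarrow> complex) set \<Rightarrow> (('v \<Rightarrow> complex) \<Rightarrow> ('v \<Rightarrow> complex)) \<Rightarrow> complex set" where
  "l2_resolvent_set D T =
     {z. bij_betw (\<lambda>f x. T f x - z * f x) D l2 \<and>
         (\<exists>C. \<forall>f\<in>D. l2_norm f \<le> C * l2_norm (\<lambda>x. T f x - z * f x))}"

definition l2_spectrum ::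
  "('v \<Rightarrow> complex) set \<Rightarrow> (('v \<Rightarrow> complex) \<Rightarrow> ('v \<Rightarrow> complex)) \<Rightarrow> complex set" where
  "l2_spectrum D T = - l2_resolvent_set D T"

definition l2_eigenspace ::
  "('v \<Rightarrow> complex) set \<Rightarrow> (('v \<Rightarrow> complex) \<Rightarrow> ('v \<Rightarrow> complex)) \<Rightarrow> complex \<Rightarrow>
   ('v \<Rightarrow> complex) set" where
  "l2_eigenspace D T z = {f \<in> D. T f = (\<lambda>x. z * f x)}"

definition finite_dim :: "('v \<Rightarrow> complex) set \<Rightarrow> bool" where
  "finite_dim E \<longleftrightarrow> (\<exists>B. finite B \<and> (\<forall>f\<in>E. \<exists>c. f = (\<lambda>x. \<Sum>g\<in>B. c g * g x)))"

definition l2_discrete_spectrum ::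
  "('v \<Rightarrow> complex) set \<Rightarrow> (('v \<Rightarrow> complex) \<Rightarrow> ('v \<Rightarrow> complex)) \<Rightarrow> complex set" where
  "l2_discrete_spectrum D T =
     {z. z isolated_in l2_spectrum D T \<and>
         (\<exists>f \<in> l2_eigenspace D T z. f \<noteq> (\<lambda>x. 0)) \<and>
         finite_dim (l2_eigenspace D T z)}"


definition finitely_supported :: "('v \<Rightarrow> complex) set" where
  "finitely_supported = {f. finite {x. f x \<noteq> 0}}"

definition energy_form ::
  "('v \<Rightarrow> 'v \<Rightarrow> real) \<Rightarrow> ('v \<Rightarrow> complex) \<Rightarrow> ('v \<Rightarrow> complex) \<Rightarrow> complex" where
  "energy_form b f g =
     1 / 2 * (\<Sum>\<^sub>\<infinity>(x, y). complex_of_real (b x y) * (f x - f y) * cnj (g x - g y))"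

definition dirichlet_dom :: "('v \<Rightarrow> 'v \<Rightarrow> real) \<Rightarrow> ('v \<Rightarrow> complex) set" where
  "dirichlet_dom b = form_closure_dom finitely_supported (energy_form b)"

definition dirichlet_form ::
  "('v \<Rightarrow> 'v \<Rightarrow> real) \<Rightarrow> ('v \<Rightarrow> complex) \<Rightarrow> ('v \<Rightarrow> complex) \<Rightarrow> complex" where
  "dirichlet_form b = form_closure finitely_supported (energy_form b)"

definition laplacian_dom :: "('v \<Rightarrow> 'v \<Rightarrow> real) \<Rightarrow> ('v \<Rightarrow> complex) set" where
  "laplacian_dom b = form_operator_dom (dirichlet_dom b) (dirichlet_form b)"

definition laplacian :: "('v \<Rightarrow> 'v \<Rightarrow> real) \<Rightarrow> ('v \<Rightarrow> complex) \<Rightarrow> ('v \<Rightarrow> complex)" where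
  "laplacian b = form_operator (dirichlet_dom b) (dirichlet_form b)"

definition laplacian_spectrum :: "('v \<Rightarrow> 'v \<Rightarrow> real) \<Rightarrow> complex set" where
  "laplacian_spectrum b = l2_spectrum (laplacian_dom b) (laplacian b)"

definition laplacian_discrete_spectrum :: "('v \<Rightarrow> 'v \<Rightarrow> real) \<Rightarrow> complex set" where
  "laplacian_discrete_spectrum b = l2_discrete_spectrum (laplacian_dom b) (laplacian b)"

text \<open>The spectrum is a nonempty set of non-negative real numbers, represented in the complex
  plane; \<open>Re\<close> only changes its type.\<close>

definition spectral_bottom :: "('v \<Rightarrow> 'v \<Rightarrow> real) \<Rightarrow> real" where
  "spectral_bottom b = Inf (Re ` laplacian_spectrum b)"

end

theory Submission
  imports Defs
begin

text \<open>
  Write \<open>s r\<close> and \<open>V r\<close> for the number of vertices in the sphere and in the ball of radius \<open>r\<close>. In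
  an antitree consecutive spheres are completely joined, so \<open>s r * s (Suc r)\<close> edges lead from radius
  \<open>r\<close> to radius \<open>Suc r\<close>. A radial function \<open>u\<close> with Laplacian \<open>1\<close> must by Gauss' theorem send the
  flux \<open>V r\<close> through these edges, that is, \<open>u r - u (Suc r) = V r / (s r * s (Suc r))\<close>. If
  \<open>s (Suc r)\<close> is comparable to \<open>r powr \<beta>\<close>, the right-hand side is of order \<open>r powr (1 - \<beta>)\<close>, hence
  summable for \<open>\<beta> > 2\<close>, and then \<open>u r = (\<Sum>k. V (k + r) / (s (k + r) * s (Suc (k + r))))\<close> is a
  positive function with Laplacian \<open>1\<close> that tends to zero at infinity (\<open>torsion_laplacian\<close>).

  A positive function \<open>u\<close> with Laplacian \<open>1\<close> yields, by Picone's inequality on every edge, the Hardy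
  inequality that the energy of \<open>\<phi>\<close> dominates the sum of \<open>(cmod (\<phi> x))\<^sup>2 / u x\<close>
  (\<open>hardy_inequality\<close>). Here the weight \<open>1 / u\<close> is at least \<open>1 / u 0 > 0\<close>, which bounds the spectrum
  away from zero, and it diverges at infinity, which makes the spectrum discrete: functions of
  bounded energy are small outside a finite set, uniformly, so the situation is compact.

  The second half of this argument concerns any non-negative selfadjoint operator \<open>T\<close> in \<open>l2\<close> whose
  quadratic form dominates a diverging potential (\<open>confined_operator\<close>). If \<open>z\<close> is not an
  eigenvalue, compactness bounds \<open>T - z\<close> from below, and selfadjointness makes it surjective, so the
  spectrum consists of eigenvalues; compactness also makes eigenspaces finite dimensional and leaves
  finitely many eigenvalues below any bound. The infimum of the Rayleigh quotient always lies in the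
  spectrum, which is therefore nonempty, so that a lower bound for its elements is one for its
  infimum.

  That the operator of the closed form is selfadjoint comes down to solving
  \<open>laplacian b f + f = h\<close>. The closed form is the closed subspace of all pairs \<open>(f, grad b f)\<close>, and
  the solution is the first component of the orthogonal projection of \<open>(h, 0)\<close> onto it
  (\<open>laplacian_nonneg_selfadjoint\<close>).
\<close>

section \<open>The Hilbert space of square summable functions\<close>

abbreviation l2_tendsto :: "(nat \<Rightarrow> 'i \<Rightarrow> complex) \<Rightarrow> ('i \<Rightarrow> complex) \<Rightarrow> bool" where
  "l2_tendsto f h \<equiv> (\<lambda>n. l2_norm (\<lambda>x. f n x - h x)) \<longlonglongrightarrow> 0"

definition l2_Cauchy :: "(nat \<Rightarrow> 'i \<Rightarrow> complex) \<Rightarrow> bool" where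
  "l2_Cauchy f \<longleftrightarrow> (\<forall>e>0. \<exists>N. \<forall>m\<ge>N. \<forall>n\<ge>N. l2_norm (\<lambda>x. f m x - f n x) < e)"

definition l2_closed_subspace :: "('i \<Rightarrow> complex) set \<Rightarrow> bool" where
  "l2_closed_subspace M \<longleftrightarrow> M \<subseteq> l2 \<and> (\<lambda>_. 0) \<in> M \<and>
     (\<forall>f\<in>M. \<forall>g\<in>M. (\<lambda>x. f x + g x) \<in> M) \<and>
     (\<forall>c. \<forall>f\<in>M. (\<lambda>x. c * f x) \<in> M) \<and>
     (\<forall>f h. (\<forall>n. f n \<in> M) \<longrightarrow> h \<in> l2 \<longrightarrow> l2_tendsto f h \<longrightarrow> h \<in> M)"

subsection \<open>Norm\<close>

lemma l2_norm_nonneg [simp]: "0 \<le> l2_norm f"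
  by (simp add: l2_norm_def infsum_nonneg)

lemma l2_norm_square: "(l2_norm f)\<^sup>2 = (\<Sum>\<^sub>\<infinity>x. (cmod (f x))\<^sup>2)"
  by (simp add: l2_norm_def infsum_nonneg)

lemma l2_norm_zero [simp]: "l2_norm (\<lambda>x. 0) = 0"
  by (simp add: l2_norm_def)

lemma l2_zero [simp, intro]: "(\<lambda>x. 0) \<in> l2"
  by (simp add: l2_def)

lemma sum_square_le_l2_norm:
  assumes "f \<in> l2" "finite F"
  shows "(\<Sum>x\<in>F. (cmod (f x))\<^sup>2) \<le> (l2_norm f)\<^sup>2"
  unfolding l2_norm_square
  by (rule finite_sum_le_infsum) (use assms in \<open>auto simp: l2_def\<close>)

lemma L2_set_le_l2_norm:
  assumes "f \<in> l2" "finite F"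
  shows "L2_set (\<lambda>x. cmod (f x)) F \<le> l2_norm f"
  unfolding L2_set_def
  using sum_square_le_l2_norm[OF assms] by (simp add: real_le_lsqrt)

lemma cmod_le_l2_norm:
  assumes "f \<in> l2"
  shows "cmod (f x) \<le> l2_norm f"
  using L2_set_le_l2_norm[OF assms, of "{x}"] by simp

text \<open>Membership and norm bounds are both statements about finite partial sums; this is how the
  finite Minkowski and Cauchy--Schwarz inequalities are transported to \<open>l2\<close>.\<close>

lemma l2_bounded_partial_sums:
  assumes "\<And>F. finite F \<Longrightarrow> (\<Sum>x\<in>F. (cmod (f x))\<^sup>2) \<le> B"
  shows "f \<in> l2" and "(l2_norm f)\<^sup>2 \<le> B"
proof -
  show f: "f \<in> l2"
    unfolding l2_def mem_Collect_eq
    by (rule nonneg_bdd_above_summable_on) (auto simp: bdd_above_def intro: assms)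
  show "(l2_norm f)\<^sup>2 \<le> B"
    unfolding l2_norm_square
    by (rule infsum_le_finite_sums) (use f assms in \<open>auto simp: l2_def\<close>)
qed

lemma l2_bounded_L2_set:
  assumes "\<And>F. finite F \<Longrightarrow> L2_set (\<lambda>x. cmod (f x)) F \<le> C"
  shows "f \<in> l2" and "l2_norm f \<le> C"
proof -
  have C: "0 \<le> C" using assms[of "{}"] by simp
  have "(\<Sum>x\<in>F. (cmod (f x))\<^sup>2) \<le> C\<^sup>2" if "finite F" for F
    using assms[OF that] unfolding L2_set_def by (rule sqrt_le_D)
  note * = l2_bounded_partial_sums[OF this]
  show "f \<in> l2" by (rule *)
  show "l2_norm f \<le> C" using *(2) C by (rule power2_le_imp_le)
qed

lemma
  assumes "f \<in> l2" "g \<in> l2"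
  shows l2_add: "(\<lambda>x. f x + g x) \<in> l2"
    and l2_norm_triangle: "l2_norm (\<lambda>x. f x + g x) \<le> l2_norm f + l2_norm g"
proof -
  have "L2_set (\<lambda>x. cmod (f x + g x)) F \<le> l2_norm f + l2_norm g" if F: "finite F" for F
  proof -
    have "L2_set (\<lambda>x. cmod (f x + g x)) F \<le> L2_set (\<lambda>x. cmod (f x) + cmod (g x)) F"
      by (rule L2_set_mono) (auto intro: norm_triangle_ineq)
    also have "\<dots> \<le> L2_set (\<lambda>x. cmod (f x)) F + L2_set (\<lambda>x. cmod (g x)) F"
      by (rule L2_set_triangle_ineq)
    also have "\<dots> \<le> l2_norm f + l2_norm g"
      using assms F by (intro add_mono L2_set_le_l2_norm)
    finally show ?thesis .
  qed
  note * = l2_bounded_L2_set[OF this]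
  show "(\<lambda>x. f x + g x) \<in> l2" by (rule *)
  show "l2_norm (\<lambda>x. f x + g x) \<le> l2_norm f + l2_norm g" by (rule *)
qed

lemma l2_cmult: "f \<in> l2 \<Longrightarrow> (\<lambda>x. c * f x) \<in> l2"
  by (simp add: l2_def norm_mult power_mult_distrib summable_on_cmult_right)

lemma l2_norm_cmult: "l2_norm (\<lambda>x. c * f x) = cmod c * l2_norm f"
  by (simp add: l2_norm_def norm_mult power_mult_distrib infsum_cmult_right' real_sqrt_mult)

lemma l2_diff: "f \<in> l2 \<Longrightarrow> g \<in> l2 \<Longrightarrow> (\<lambda>x. f x - g x) \<in> l2"
  using l2_add[of f "\<lambda>x. -1 * g x"] l2_cmult[of g "-1"] by simp

lemma l2_norm_uminus: "l2_norm (\<lambda>x. - f x) = l2_norm f"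
  using l2_norm_cmult[of "-1" f] by simp

lemma l2_norm_minus_commute: "l2_norm (\<lambda>x. f x - g x) = l2_norm (\<lambda>x. g x - f x)"
  by (simp add: l2_norm_def norm_minus_commute)

lemma l2_norm_triangle_diff:
  assumes "f \<in> l2" "g \<in> l2"
  shows "l2_norm (\<lambda>x. f x - g x) \<le> l2_norm f + l2_norm g"
  using l2_norm_triangle[of f "\<lambda>x. -1 * g x"] l2_cmult[of g "-1"] assms
  by (simp add: l2_norm_uminus)

lemma l2_dist_triangle:
  assumes "f \<in> l2" "g \<in> l2" "h \<in> l2"
  shows "l2_norm (\<lambda>x. f x - h x) \<le> l2_norm (\<lambda>x. f x - g x) + l2_norm (\<lambda>x. g x - h x)"
  using l2_norm_triangle[OF l2_diff[OF assms(1,2)] l2_diff[OF assms(2,3)]] by simp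

lemma l2_norm_eq_0_iff:
  assumes "f \<in> l2"
  shows "l2_norm f = 0 \<longleftrightarrow> f = (\<lambda>x. 0)"
proof
  assume "l2_norm f = 0"
  then have "cmod (f x) \<le> 0" for x using cmod_le_l2_norm[OF assms, of x] by simp
  then show "f = (\<lambda>x. 0)" by auto
qed simp

lemma finite_support_l2:
  assumes "finite {x. f x \<noteq> 0}"
  shows "f \<in> l2"
proof -
  have "(\<lambda>x. (cmod (f x))\<^sup>2) summable_on {x. f x \<noteq> 0}"
    using assms by (rule summable_on_finite)
  then have "(\<lambda>x. (cmod (f x))\<^sup>2) summable_on UNIV"
    by (rule summable_on_cong_neutral[THEN iffD1, rotated -1]) auto
  then show ?thesis by (simp add: l2_def)
qed

subsection \<open>Inner product\<close>

lemma l2_inner_summable: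
  assumes "f \<in> l2" "g \<in> l2"
  shows "(\<lambda>x. cmod (f x * cnj (g x))) summable_on UNIV"
proof (rule summable_on_comparison_test)
  show "(\<lambda>x. (cmod (f x))\<^sup>2 + (cmod (g x))\<^sup>2) summable_on UNIV"
    using assms by (intro summable_on_add) (auto simp: l2_def)
  show "cmod (f x * cnj (g x)) \<le> (cmod (f x))\<^sup>2 + (cmod (g x))\<^sup>2" for x
  proof -
    have "0 \<le> cmod (f x) * cmod (g x)" by simp
    then show ?thesis
      using sum_squares_bound[of "cmod (f x)" "cmod (g x)"]
      unfolding norm_mult complex_mod_cnj by linarith
  qed
qed auto

lemma l2_inner_summable': "f \<in> l2 \<Longrightarrow> g \<in> l2 \<Longrightarrow> (\<lambda>x. f x * cnj (g x)) summable_on UNIV"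
  using l2_inner_summable by (rule abs_summable_summable)

lemma l2_inner_commute: "l2_inner g f = cnj (l2_inner f g)"
  unfolding l2_inner_def infsum_cnj[symmetric] by (simp add: mult.commute)

lemma l2_inner_add_left:
  assumes "f \<in> l2" "g \<in> l2" "h \<in> l2"
  shows "l2_inner (\<lambda>x. f x + g x) h = l2_inner f h + l2_inner g h"
  using assms by (simp add: l2_inner_def distrib_right infsum_add l2_inner_summable')

lemma l2_inner_cmult_left: "l2_inner (\<lambda>x. c * f x) h = c * l2_inner f h"
  by (simp add: l2_inner_def mult.assoc infsum_cmult_right')

lemma l2_inner_cmult_right: "l2_inner f (\<lambda>x. c * h x) = cnj c * l2_inner f h"
  by (metis complex_cnj_mult l2_inner_cmult_left l2_inner_commute)

lemma l2_inner_diff_left: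
  assumes "f \<in> l2" "g \<in> l2" "h \<in> l2"
  shows "l2_inner (\<lambda>x. f x - g x) h = l2_inner f h - l2_inner g h"
  using l2_inner_add_left[of f "\<lambda>x. -1 * g x" h] l2_inner_cmult_left[of "-1" g h]
    l2_cmult[of g "-1"] assms by simp

lemma l2_inner_add_right:
  assumes "f \<in> l2" "g \<in> l2" "h \<in> l2"
  shows "l2_inner h (\<lambda>x. f x + g x) = l2_inner h f + l2_inner h g"
  using l2_inner_add_left[OF assms] by (metis complex_cnj_add l2_inner_commute)

lemma l2_inner_diff_right:
  assumes "f \<in> l2" "g \<in> l2" "h \<in> l2"
  shows "l2_inner h (\<lambda>x. f x - g x) = l2_inner h f - l2_inner h g"
  using l2_inner_diff_left[OF assms] by (metis complex_cnj_diff l2_inner_commute)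

lemma l2_inner_self:
  assumes "f \<in> l2"
  shows "l2_inner f f = complex_of_real ((l2_norm f)\<^sup>2)"
proof -
  have "((\<lambda>x. (cmod (f x))\<^sup>2) has_sum (l2_norm f)\<^sup>2) UNIV"
    using assms unfolding l2_norm_square by (simp add: l2_def)
  then have "((\<lambda>x. f x * cnj (f x)) has_sum complex_of_real ((l2_norm f)\<^sup>2)) UNIV"
    unfolding complex_norm_square[symmetric] by (rule has_sum_of_real)
  then show ?thesis
    unfolding l2_inner_def by (rule infsumI)
qed

lemma l2_cauchy_schwarz:
  assumes "f \<in> l2" "g \<in> l2"
  shows "cmod (l2_inner f g) \<le> l2_norm f * l2_norm g"
proof -
  have "cmod (l2_inner f g) \<le> (\<Sum>\<^sub>\<infinity>x. cmod (f x * cnj (g x)))"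
    unfolding l2_inner_def using l2_inner_summable[OF assms] by (rule norm_infsum_bound)
  also have "\<dots> \<le> l2_norm f * l2_norm g"
  proof (rule infsum_le_finite_sums)
    fix F :: "'a set" assume F: "finite F"
    have "(\<Sum>x\<in>F. cmod (f x * cnj (g x))) \<le>
        L2_set (\<lambda>x. cmod (f x)) F * L2_set (\<lambda>x. cmod (g x)) F"
      using L2_set_mult_ineq[of "\<lambda>x. cmod (f x)" "\<lambda>x. cmod (g x)" F] by (simp add: norm_mult)
    also have "\<dots> \<le> l2_norm f * l2_norm g"
      using assms F by (intro mult_mono L2_set_le_l2_norm) auto
    finally show "(\<Sum>x\<in>F. cmod (f x * cnj (g x))) \<le> l2_norm f * l2_norm g" .
  qed (use l2_inner_summable[OF assms] in auto)
  finally show ?thesis .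
qed

lemma l2_norm_diff_square:
  assumes "f \<in> l2" "g \<in> l2"
  shows "(l2_norm (\<lambda>x. f x - g x))\<^sup>2 = (l2_norm f)\<^sup>2 - 2 * Re (l2_inner f g) + (l2_norm g)\<^sup>2"
proof -
  have "complex_of_real ((l2_norm (\<lambda>x. f x - g x))\<^sup>2) =
      complex_of_real ((l2_norm f)\<^sup>2) - (l2_inner f g + cnj (l2_inner f g))
      + complex_of_real ((l2_norm g)\<^sup>2)"
    using assms
    unfolding l2_inner_self[OF assms(1), symmetric] l2_inner_self[OF assms(2), symmetric]
      l2_inner_self[OF l2_diff[OF assms], symmetric]
    by (simp add: l2_inner_diff_left l2_inner_diff_right l2_diff
        l2_inner_commute[of g f])
  then have "complex_of_real ((l2_norm (\<lambda>x. f x - g x))\<^sup>2) =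
      complex_of_real ((l2_norm f)\<^sup>2 - 2 * Re (l2_inner f g) + (l2_norm g)\<^sup>2)"
    by (simp add: complex_add_cnj)
  then show ?thesis by (simp only: of_real_eq_iff)
qed

definition point_mass :: "'i \<Rightarrow> 'i \<Rightarrow> complex" where
  "point_mass x = (\<lambda>y. if y = x then 1 else 0)"

lemma point_mass_finitely_supported: "point_mass x \<in> finitely_supported"
  by (simp add: point_mass_def finitely_supported_def)

lemma point_mass_l2: "point_mass x \<in> l2"
  by (rule finite_support_l2) (simp add: point_mass_def)

text \<open>Point masses recover a function from its inner products with finitely supported functions;
  this is why the operator of a form is uniquely determined.\<close>

lemma l2_inner_point_mass: "l2_inner f (point_mass x) = f x"
proof -
  have "l2_inner f (point_mass x) = (\<Sum>\<^sub>\<infinity>y\<in>{x}. f y * cnj (point_mass x y))"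
    unfolding l2_inner_def by (rule infsum_cong_neutral) (auto simp: point_mass_def)
  then show ?thesis by (simp add: point_mass_def)
qed

subsection \<open>Direct sums\<close>

lemma l2_sum_type_iff:
  "h \<in> l2 \<longleftrightarrow> (\<lambda>x. h (Inl x)) \<in> l2 \<and> (\<lambda>x. h (Inr x)) \<in> l2"
proof -
  let ?f = "\<lambda>x. (cmod (h x))\<^sup>2"
  have "?f summable_on UNIV \<longleftrightarrow> ?f summable_on range Inl \<and> ?f summable_on range Inr"
    unfolding UNIV_sum
    by (auto intro: summable_on_Un_disjoint elim: summable_on_subset)
  then show ?thesis
    by (simp add: l2_def summable_on_reindex o_def)
qed

lemma l2_inner_sum_type:
  assumes "h \<in> l2" "k \<in> l2"
  shows "l2_inner h k =
    l2_inner (\<lambda>x. h (Inl x)) (\<lambda>x. k (Inl x)) + l2_inner (\<lambda>x. h (Inr x)) (\<lambda>x. k (Inr x))"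
proof -
  have *: "(\<lambda>x. h x * cnj (k x)) summable_on UNIV" by (rule l2_inner_summable'[OF assms])
  have "l2_inner h k =
      (\<Sum>\<^sub>\<infinity>x\<in>range Inl. h x * cnj (k x)) + (\<Sum>\<^sub>\<infinity>x\<in>range Inr. h x * cnj (k x))"
    unfolding l2_inner_def UNIV_sum
    by (intro infsum_Un_disjoint summable_on_subset[OF *]) auto
  then show ?thesis by (simp add: l2_inner_def infsum_reindex o_def)
qed

lemma l2_norm_sum_type:
  assumes "h \<in> l2"
  shows "(l2_norm h)\<^sup>2 = (l2_norm (\<lambda>x. h (Inl x)))\<^sup>2 + (l2_norm (\<lambda>x. h (Inr x)))\<^sup>2"
proof -
  have "complex_of_real ((l2_norm h)\<^sup>2) =
      complex_of_real ((l2_norm (\<lambda>x. h (Inl x)))\<^sup>2 + (l2_norm (\<lambda>x. h (Inr x)))\<^sup>2)"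
    using assms l2_inner_sum_type[OF assms assms] by (simp add: l2_inner_self l2_sum_type_iff)
  then show ?thesis by (simp only: of_real_eq_iff)
qed

subsection \<open>Completeness and orthogonal projections\<close>

lemma l2_tendsto_pointwise:
  assumes "\<And>n. f n \<in> l2" "h \<in> l2" "l2_tendsto f h"
  shows "(\<lambda>n. f n x) \<longlonglongrightarrow> h x"
proof -
  have "(\<lambda>n. f n x - h x) \<longlonglongrightarrow> 0"
    by (rule Lim_null_comparison[OF _ assms(3)])
      (use cmod_le_l2_norm[OF l2_diff[OF assms(1,2)]] in auto)
  then show ?thesis by (simp add: LIM_zero_iff)
qed

lemma l2_tendsto_unique:
  assumes "\<And>n. f n \<in> l2" "g \<in> l2" "h \<in> l2" "l2_tendsto f g" "l2_tendsto f h"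
  shows "g = h"
  using l2_tendsto_pointwise[OF assms(1,2,4)] l2_tendsto_pointwise[OF assms(1,3,5)]
  by (auto intro: LIMSEQ_unique)

lemma l2_norm_diff_abs:
  assumes "f \<in> l2" "g \<in> l2"
  shows "\<bar>l2_norm f - l2_norm g\<bar> \<le> l2_norm (\<lambda>x. f x - g x)"
proof -
  have "l2_norm f \<le> l2_norm (\<lambda>x. f x - g x) + l2_norm g"
    using l2_norm_triangle[OF l2_diff[OF assms] assms(2)] by simp
  moreover have "l2_norm g \<le> l2_norm (\<lambda>x. g x - f x) + l2_norm f"
    using l2_norm_triangle[OF l2_diff[OF assms(2,1)] assms(1)] by simp
  ultimately show ?thesis by (simp add: l2_norm_minus_commute[of g f])
qed

lemma l2_tendsto_norm:
  assumes "\<And>n. f n \<in> l2" "h \<in> l2" "l2_tendsto f h"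
  shows "(\<lambda>n. l2_norm (f n)) \<longlonglongrightarrow> l2_norm h"
proof -
  have "(\<lambda>n. l2_norm (f n) - l2_norm h) \<longlonglongrightarrow> 0"
    by (rule Lim_null_comparison[OF _ assms(3)]) (use l2_norm_diff_abs[OF assms(1,2)] in auto)
  then show ?thesis by (simp add: LIM_zero_iff)
qed

lemma l2_tendsto_inner:
  assumes f: "\<And>n. f n \<in> l2" "F \<in> l2" "l2_tendsto f F"
    and g: "\<And>n. g n \<in> l2" "G \<in> l2" "l2_tendsto g G"
  shows "(\<lambda>n. l2_inner (f n) (g n)) \<longlonglongrightarrow> l2_inner F G"
proof -
  have "(\<lambda>n. l2_inner (f n) (g n) - l2_inner F G) \<longlonglongrightarrow> 0"
  proof (rule Lim_null_comparison)
    have "(\<lambda>n. l2_norm (\<lambda>x. f n x - F x) * l2_norm (g n) + l2_norm F * l2_norm (\<lambda>x. g n x - G x))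
        \<longlonglongrightarrow> 0 * l2_norm G + l2_norm F * 0"
      by (intro tendsto_intros f(3) g(3) l2_tendsto_norm g)
    then show "(\<lambda>n. l2_norm (\<lambda>x. f n x - F x) * l2_norm (g n)
        + l2_norm F * l2_norm (\<lambda>x. g n x - G x)) \<longlonglongrightarrow> 0" by simp
    have "cmod (l2_inner (f n) (g n) - l2_inner F G) \<le>
        l2_norm (\<lambda>x. f n x - F x) * l2_norm (g n) + l2_norm F * l2_norm (\<lambda>x. g n x - G x)" for n
    proof -
      have "l2_inner (f n) (g n) - l2_inner F G =
          l2_inner (\<lambda>x. f n x - F x) (g n) + l2_inner F (\<lambda>x. g n x - G x)"
        by (simp add: l2_inner_diff_left l2_inner_diff_right f g)
      also have "cmod \<dots> \<le> cmod (l2_inner (\<lambda>x. f n x - F x) (g n))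
          + cmod (l2_inner F (\<lambda>x. g n x - G x))" by (rule norm_triangle_ineq)
      also have "\<dots> \<le> l2_norm (\<lambda>x. f n x - F x) * l2_norm (g n)
          + l2_norm F * l2_norm (\<lambda>x. g n x - G x)"
        by (intro add_mono l2_cauchy_schwarz l2_diff f g)
      finally show ?thesis .
    qed
    then show "\<forall>\<^sub>F n in sequentially. norm (l2_inner (f n) (g n) - l2_inner F G) \<le>
        l2_norm (\<lambda>x. f n x - F x) * l2_norm (g n) + l2_norm F * l2_norm (\<lambda>x. g n x - G x)"
      by simp
  qed
  then show ?thesis by (simp add: LIM_zero_iff)
qed

lemma l2_tendsto_imp_Cauchy:
  assumes "\<And>n. f n \<in> l2" "h \<in> l2" "l2_tendsto f h"
  shows "l2_Cauchy f"
  unfolding l2_Cauchy_def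
proof (intro allI impI)
  fix e :: real assume "e > 0"
  then obtain N where N: "\<And>n. n \<ge> N \<Longrightarrow> l2_norm (\<lambda>x. f n x - h x) < e / 2"
    using LIMSEQ_D[OF assms(3), of "e / 2"] by auto
  show "\<exists>N. \<forall>m\<ge>N. \<forall>n\<ge>N. l2_norm (\<lambda>x. f m x - f n x) < e"
  proof (intro exI allI impI)
    fix m n assume "m \<ge> N" "n \<ge> N"
    then show "l2_norm (\<lambda>x. f m x - f n x) < e"
      using l2_dist_triangle[OF assms(1)[of m] assms(2) assms(1)[of n]] N[of m] N[of n]
      by (simp add: l2_norm_minus_commute[of h])
  qed
qed

text \<open>The pointwise limit of a Cauchy sequence is its limit in norm, because bounds on finite
  partial sums survive pointwise limits.\<close>

lemma l2_complete:
  assumes f: "\<And>n. f n \<in> l2" and Cauchy: "l2_Cauchy f"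
  obtains h where "h \<in> l2" "l2_tendsto f h"
proof -
  have "convergent (\<lambda>n. f n x)" for x
  proof (rule Cauchy_convergent, rule CauchyI)
    fix e :: real assume "e > 0"
    then obtain N where "\<And>m n. m \<ge> N \<Longrightarrow> n \<ge> N \<Longrightarrow> l2_norm (\<lambda>x. f m x - f n x) < e"
      using Cauchy unfolding l2_Cauchy_def by blast
    then show "\<exists>M. \<forall>m\<ge>M. \<forall>n\<ge>M. norm (f m x - f n x) < e"
      using cmod_le_l2_norm[OF l2_diff[OF f f]] by (meson le_less_trans)
  qed
  then obtain h where h: "\<And>x. (\<lambda>n. f n x) \<longlonglongrightarrow> h x"
    unfolding convergent_def by metis
  have tail: "(\<lambda>x. f n x - h x) \<in> l2 \<and> l2_norm (\<lambda>x. f n x - h x) \<le> e"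
    if N: "\<And>m. m \<ge> N \<Longrightarrow> l2_norm (\<lambda>x. f n x - f m x) \<le> e" for n N e
  proof -
    have "L2_set (\<lambda>x. cmod (f n x - h x)) F \<le> e" if F: "finite F" for F
    proof (rule Lim_bounded)
      show "(\<lambda>m. L2_set (\<lambda>x. cmod (f n x - f m x)) F) \<longlonglongrightarrow> L2_set (\<lambda>x. cmod (f n x - h x)) F"
        unfolding L2_set_def by (intro tendsto_intros h)
      show "\<forall>m\<ge>N. L2_set (\<lambda>x. cmod (f n x - f m x)) F \<le> e"
        using L2_set_le_l2_norm[OF l2_diff[OF f f] F] N by (meson order_trans)
    qed
    from l2_bounded_L2_set[OF this] show ?thesis by simp
  qed
  obtain N where N: "\<And>m n. m \<ge> N \<Longrightarrow> n \<ge> N \<Longrightarrow> l2_norm (\<lambda>x. f m x - f n x) < 1"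
    using Cauchy unfolding l2_Cauchy_def by (meson zero_less_one)
  have "(\<lambda>x. f N x - h x) \<in> l2" using tail[of N N 1] N by (meson order.refl less_imp_le)
  from l2_diff[OF f[of N] this] have hl: "h \<in> l2" by simp
  have "l2_tendsto f h"
  proof (rule LIMSEQ_I)
    fix e :: real assume "e > 0"
    then obtain N where "\<And>m n. m \<ge> N \<Longrightarrow> n \<ge> N \<Longrightarrow> l2_norm (\<lambda>x. f m x - f n x) < e / 2"
      using Cauchy unfolding l2_Cauchy_def by (meson half_gt_zero)
    then have "l2_norm (\<lambda>x. f n x - h x) \<le> e / 2" if "n \<ge> N" for n
      using tail[of N n "e/2"] that by (meson less_imp_le)
    then show "\<exists>no. \<forall>n\<ge>no. norm (l2_norm (\<lambda>x. f n x - h x) - 0) < e"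
      using \<open>e > 0\<close> by (intro exI[of _ N]) (auto intro: le_less_trans[where y = "e / 2"])
  qed
  with hl show ?thesis by (rule that)
qed

text \<open>A minimizing sequence for the distance of \<open>h\<close> to \<open>M\<close> is Cauchy by the parallelogram law;
  at the minimizer \<open>p\<close> the first variation vanishes.\<close>

theorem l2_orthogonal_projection:
  assumes M: "l2_closed_subspace M" and h: "h \<in> l2"
  obtains p where "p \<in> M" "\<And>m. m \<in> M \<Longrightarrow> l2_inner (\<lambda>x. h x - p x) m = 0"
proof -
  have Ml2: "\<And>m. m \<in> M \<Longrightarrow> m \<in> l2" and M0: "(\<lambda>_. 0) \<in> M"
    and Madd: "\<And>f g. f \<in> M \<Longrightarrow> g \<in> M \<Longrightarrow> (\<lambda>x. f x + g x) \<in> M"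
    and Mc: "\<And>c f. f \<in> M \<Longrightarrow> (\<lambda>x. c * f x) \<in> M"
    and Mcl: "\<And>f h. (\<And>n. f n \<in> M) \<Longrightarrow> h \<in> l2 \<Longrightarrow> l2_tendsto f h \<Longrightarrow> h \<in> M"
    using M unfolding l2_closed_subspace_def by blast+
  define A where "A = (\<lambda>m. (l2_norm (\<lambda>x. h x - m x))\<^sup>2) ` M"
  define d where "d = Inf A"
  have Ane: "A \<noteq> {}" using M0 by (auto simp: A_def)
  have Abd: "bdd_below A" by (auto simp: A_def intro!: bdd_belowI[of _ 0])
  have dle: "d \<le> (l2_norm (\<lambda>x. h x - m x))\<^sup>2" if "m \<in> M" for m
    unfolding d_def by (rule cInf_lower) (use that Abd in \<open>auto simp: A_def\<close>)
  have "\<exists>m\<in>M. (l2_norm (\<lambda>x. h x - m x))\<^sup>2 < d + 1 / real (Suc n)" for n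
    using cInf_lessD[OF Ane, of "d + 1 / real (Suc n)"] by (auto simp: A_def d_def)
  then obtain m where m: "\<And>n. m n \<in> M"
    and md: "\<And>n. (l2_norm (\<lambda>x. h x - m n x))\<^sup>2 < d + 1 / real (Suc n)"
    by metis
  note ml2 = Ml2[OF m]
  have par: "(l2_norm (\<lambda>x. m i x - m j x))\<^sup>2 \<le> 2 / real (Suc i) + 2 / real (Suc j)" for i j
  proof -
    define a where "a = (\<lambda>x. h x - m i x)"
    define c where "c = (\<lambda>x. h x - m j x)"
    have ac: "a \<in> l2" "c \<in> l2" using h ml2 by (auto simp: a_def c_def intro: l2_diff)
    have "(\<lambda>x. (1/2) * (m i x + m j x)) \<in> M" using m by (intro Mc Madd)
    from dle[OF this]
    have "d \<le> (l2_norm (\<lambda>x. (1/2) * (a x + c x)))\<^sup>2"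
      by (simp add: a_def c_def algebra_simps)
    then have "4 * d \<le> (l2_norm (\<lambda>x. a x - (-1) * c x))\<^sup>2"
      unfolding l2_norm_cmult by (simp add: power_mult_distrib power_divide)
    also have "\<dots> = (l2_norm a)\<^sup>2 + 2 * Re (l2_inner a c) + (l2_norm c)\<^sup>2"
      by (subst l2_norm_diff_square)
         (use ac l2_cmult[of c "-1"] l2_inner_cmult_right[of a "-1" c] in \<open>auto simp: l2_norm_uminus\<close>)
    finally have "(l2_norm (\<lambda>x. c x - a x))\<^sup>2 \<le> 2 * (l2_norm a)\<^sup>2 + 2 * (l2_norm c)\<^sup>2 - 4 * d"
      using l2_norm_diff_square[OF ac] by (simp add: l2_norm_minus_commute[of c a])
    moreover have "(\<lambda>x. c x - a x) = (\<lambda>x. m i x - m j x)" by (auto simp: a_def c_def)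
    ultimately show ?thesis using md[of i] md[of j] by (simp add: a_def c_def)
  qed
  have "l2_Cauchy m"
    unfolding l2_Cauchy_def
  proof (intro allI impI)
    fix e :: real assume e: "e > 0"
    obtain N where N: "4 / e\<^sup>2 < real N" using reals_Archimedean2 by blast
    show "\<exists>N. \<forall>i\<ge>N. \<forall>j\<ge>N. l2_norm (\<lambda>x. m i x - m j x) < e"
    proof (intro exI allI impI)
      fix i j assume ij: "i \<ge> N" "j \<ge> N"
      have small: "2 / real (Suc k) < e\<^sup>2 / 2" if "k \<ge> N" for k
      proof -
        have "4 / e\<^sup>2 < real (Suc k)" using N that by simp
        then have "4 < real (Suc k) * e\<^sup>2" using e by (simp add: divide_less_eq)
        then show ?thesis by (simp add: field_simps)
      qed
      have "(l2_norm (\<lambda>x. m i x - m j x))\<^sup>2 < e\<^sup>2"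
        using par[of i j] small[OF ij(1)] small[OF ij(2)] by simp
      then show "l2_norm (\<lambda>x. m i x - m j x) < e" using e by (simp add: power2_less_imp_less)
    qed
  qed
  then obtain p where p: "p \<in> l2" "l2_tendsto m p" using l2_complete[of m] ml2 by blast
  have pM: "p \<in> M" using Mcl[OF m p] .
  have "(\<lambda>n. (l2_norm (\<lambda>x. h x - m n x))\<^sup>2) \<longlonglongrightarrow> (l2_norm (\<lambda>x. h x - p x))\<^sup>2"
    by (intro tendsto_power l2_tendsto_norm l2_diff h ml2 p)
       (use p(2) in \<open>simp add: l2_norm_minus_commute[of p]\<close>)
  moreover have "(\<lambda>n. d + 1 / real (Suc n)) \<longlonglongrightarrow> d + 0"
    by (intro tendsto_intros LIMSEQ_Suc[OF lim_1_over_n])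
  ultimately have pd: "(l2_norm (\<lambda>x. h x - p x))\<^sup>2 \<le> d"
    using LIMSEQ_le[of _ _ _ d] md by (metis (no_types, lifting) add.right_neutral less_imp_le)
  define r where "r = (\<lambda>x. h x - p x)"
  have rl2: "r \<in> l2" using h p by (auto simp: r_def intro: l2_diff)
  have "l2_inner r k = 0" if k: "k \<in> M" for k
  proof -
    define c where "c = l2_inner r k"
    \<comment> \<open>Any positive \<open>t\<close> with \<open>t * (l2_norm k)\<^sup>2 < 2\<close> makes the first order term dominate.\<close>
    define t where "t = 1 / ((l2_norm k)\<^sup>2 + 1)"
    have t: "t > 0" by (simp add: t_def add_nonneg_pos)
    define v where "v = (\<lambda>x. complex_of_real t * c * k x)"
    have vl2: "v \<in> l2" using Ml2[OF k] unfolding v_def by (rule l2_cmult)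
    have "(\<lambda>x. p x + v x) \<in> M" unfolding v_def by (intro Madd pM Mc k)
    from pd dle[OF this] have "(l2_norm r)\<^sup>2 \<le> (l2_norm (\<lambda>x. r x - v x))\<^sup>2"
      unfolding r_def diff_diff_eq by (rule order_trans)
    also have "\<dots> = (l2_norm r)\<^sup>2 - 2 * Re (l2_inner r v) + (l2_norm v)\<^sup>2"
      by (rule l2_norm_diff_square[OF rl2 vl2])
    also have "l2_inner r v = complex_of_real (t * (cmod c)\<^sup>2)"
      unfolding v_def l2_inner_cmult_right c_def[symmetric]
      by (simp only: of_real_mult complex_norm_square) simp
    also have "(l2_norm v)\<^sup>2 = t * (cmod c)\<^sup>2 * (t * (l2_norm k)\<^sup>2)"
      unfolding v_def l2_norm_cmult using t
      by (simp add: norm_mult power_mult_distrib power2_eq_square)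
    finally have "0 \<le> t * (cmod c)\<^sup>2 * (t * (l2_norm k)\<^sup>2 - 2)" by (simp add: algebra_simps)
    moreover have "t * (l2_norm k)\<^sup>2 \<le> 1" by (simp add: t_def divide_le_eq add_nonneg_pos)
    ultimately have "t * (cmod c)\<^sup>2 \<le> 0"
      by (smt (verit, best) mult_pos_neg)
    then show ?thesis using t by (simp add: c_def mult_le_0_iff)
  qed
  with pM show ?thesis by (intro that) (auto simp: r_def)
qed

section \<open>Operators confined by a diverging potential\<close>

text \<open>For a symmetric non-negative operator, surjectivity of \<open>T + 1\<close> is equivalent to selfadjointness,
  and it is the form in which selfadjointness is both easy to verify and easy to use.\<close>

locale nonneg_selfadjoint_operator =
  fixes D :: "('i \<Rightarrow> complex) set" and T :: "('i \<Rightarrow> complex) \<Rightarrow> ('i \<Rightarrow> complex)"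
  assumes D_l2: "f \<in> D \<Longrightarrow> f \<in> l2"
    and T_l2: "f \<in> D \<Longrightarrow> T f \<in> l2"
    and D_add: "f \<in> D \<Longrightarrow> g \<in> D \<Longrightarrow> (\<lambda>x. f x + g x) \<in> D"
    and D_cmult: "f \<in> D \<Longrightarrow> (\<lambda>x. a * f x) \<in> D"
    and T_add: "f \<in> D \<Longrightarrow> g \<in> D \<Longrightarrow> T (\<lambda>x. f x + g x) = (\<lambda>x. T f x + T g x)"
    and T_cmult: "f \<in> D \<Longrightarrow> T (\<lambda>x. a * f x) = (\<lambda>x. a * T f x)"
    and symmetric: "f \<in> D \<Longrightarrow> g \<in> D \<Longrightarrow> l2_inner (T f) g = l2_inner f (T g)"
    and nonneg: "f \<in> D \<Longrightarrow> 0 \<le> Re (l2_inner (T f) f)"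
    and plus_identity_onto: "h \<in> l2 \<Longrightarrow> \<exists>f\<in>D. (\<lambda>x. T f x + f x) = h"
begin

lemma D_diff: "f \<in> D \<Longrightarrow> g \<in> D \<Longrightarrow> (\<lambda>x. f x - g x) \<in> D"
  using D_add[of f "\<lambda>x. -1 * g x"] D_cmult[of g "-1"] by simp

lemma T_diff: "f \<in> D \<Longrightarrow> g \<in> D \<Longrightarrow> T (\<lambda>x. f x - g x) = (\<lambda>x. T f x - T g x)"
  using T_add[of f "\<lambda>x. -1 * g x"] D_cmult[of g "-1"] T_cmult[of g "-1"] by simp

lemma zero_in_D: "(\<lambda>x. 0) \<in> D"
  using plus_identity_onto[OF l2_zero] D_cmult[of _ 0] by auto

lemma T_zero: "T (\<lambda>x. 0) = (\<lambda>x. 0)"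
  using T_cmult[OF zero_in_D, of 0] by simp

lemma minus_scalar_l2: "f \<in> D \<Longrightarrow> (\<lambda>x. T f x - z * f x) \<in> l2"
  by (intro l2_diff l2_cmult T_l2 D_l2)

lemma l2_norm_le_plus_identity:
  assumes f: "f \<in> D"
  shows "l2_norm f \<le> l2_norm (\<lambda>x. T f x + f x)"
proof -
  have "(l2_norm f)\<^sup>2 \<le> Re (l2_inner (T f) f) + (l2_norm f)\<^sup>2"
    using nonneg[OF f] by simp
  also have "\<dots> = Re (l2_inner (\<lambda>x. T f x + f x) f)"
    by (simp only: l2_inner_add_left[OF T_l2 D_l2 D_l2, OF f f f] l2_inner_self[OF D_l2[OF f]]
        plus_complex.sel Re_complex_of_real)
  also have "\<dots> \<le> l2_norm (\<lambda>x. T f x + f x) * l2_norm f"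
    using l2_cauchy_schwarz[OF l2_add[OF T_l2 D_l2, OF f f] D_l2[OF f]]
    by (meson complex_Re_le_cmod order_trans)
  finally have "l2_norm f * l2_norm f \<le> l2_norm (\<lambda>x. T f x + f x) * l2_norm f"
    by (simp add: power2_eq_square)
  then show ?thesis
    by (metis l2_norm_nonneg less_eq_real_def mult_right_le_imp_le)
qed

text \<open>A limit point \<open>(g, h)\<close> of the graph is compared with the solution \<open>g'\<close> of \<open>T g' + g' = h + g\<close>:
  since \<open>T + 1\<close> is bounded below, the approximants of \<open>g\<close> also converge to \<open>g'\<close>.\<close>

lemma graph_closed:
  assumes fD: "\<And>n. f n \<in> D" and g: "g \<in> l2" and h: "h \<in> l2"
    and fg: "l2_tendsto f g" and Tfh: "l2_tendsto (\<lambda>n. T (f n)) h"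
  shows "g \<in> D" and "T g = h"
proof -
  obtain g' where g'D: "g' \<in> D" and g': "(\<lambda>x. T g' x + g' x) = (\<lambda>x. h x + g x)"
    using plus_identity_onto[OF l2_add[OF h g]] by blast
  have "l2_norm (\<lambda>x. f n x - g' x) \<le>
      l2_norm (\<lambda>x. T (f n) x - h x) + l2_norm (\<lambda>x. f n x - g x)" for n
  proof -
    have "l2_norm (\<lambda>x. f n x - g' x) \<le>
        l2_norm (\<lambda>x. (T (f n) x - T g' x) + (f n x - g' x))"
      using l2_norm_le_plus_identity[OF D_diff[OF fD g'D]] unfolding T_diff[OF fD g'D] .
    also have "(\<lambda>x. (T (f n) x - T g' x) + (f n x - g' x)) =
        (\<lambda>x. (T (f n) x - h x) + (f n x - g x))"
      using fun_cong[OF g'] by (auto simp: fun_eq_iff algebra_simps)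
    also have "l2_norm \<dots> \<le> l2_norm (\<lambda>x. T (f n) x - h x) + l2_norm (\<lambda>x. f n x - g x)"
      by (intro l2_norm_triangle l2_diff T_l2 fD D_l2 g h)
    finally show ?thesis .
  qed
  then have "l2_tendsto f g'"
    by (intro Lim_null_comparison[OF _ tendsto_add_zero[OF Tfh fg]]) auto
  then have "g = g'"
    by (rule l2_tendsto_unique[OF D_l2[OF fD] g D_l2[OF g'D] fg])
  moreover from this have "T g' = h" using g' by (simp add: fun_eq_iff)
  ultimately show "g \<in> D" "T g = h" using g'D by simp_all
qed

text \<open>The same comparison shows that \<open>T\<close> equals its adjoint: if \<open>T k' + k' = h + k\<close>, then \<open>k - k'\<close> is
  orthogonal to the range of \<open>T + 1\<close>.\<close>

lemma adjoint_domain: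
  assumes k: "k \<in> l2" and h: "h \<in> l2"
    and adj: "\<And>f. f \<in> D \<Longrightarrow> l2_inner (T f) k = l2_inner f h"
  shows "k \<in> D" and "T k = h"
proof -
  obtain k' where k'D: "k' \<in> D" and k': "(\<lambda>x. T k' x + k' x) = (\<lambda>x. h x + k x)"
    using plus_identity_onto[OF l2_add[OF h k]] by blast
  have "k \<in> l2" "k' \<in> l2" using k D_l2 k'D by auto
  then have diff: "(\<lambda>x. k x - k' x) \<in> l2" by (rule l2_diff)
  obtain f where f: "f \<in> D" and Tf: "(\<lambda>x. T f x + f x) = (\<lambda>x. k x - k' x)"
    using plus_identity_onto[OF diff] by blast
  note l2s = T_l2[OF f] D_l2[OF f] k h D_l2[OF k'D] T_l2[OF k'D]
  have "l2_inner (\<lambda>x. T f x + f x) k = l2_inner f (\<lambda>x. h x + k x)"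
    using l2s adj[OF f] by (simp add: l2_inner_add_left l2_inner_add_right)
  also have "\<dots> = l2_inner (\<lambda>x. T f x + f x) k'"
    unfolding k'[symmetric]
    using l2s symmetric[OF f k'D] by (simp add: l2_inner_add_left l2_inner_add_right)
  finally have "l2_inner (\<lambda>x. k x - k' x) (\<lambda>x. k x - k' x) = 0"
    using l2s unfolding Tf by (simp add: l2_inner_diff_right diff)
  then have "(\<lambda>x. k x - k' x) = (\<lambda>x. 0)"
    using l2_norm_eq_0_iff[OF diff] by (simp add: l2_inner_self[OF diff])
  then have "k = k'" by (auto simp: fun_eq_iff)
  moreover from this have "T k' = h" using k' by (simp add: fun_eq_iff)
  ultimately show "k \<in> D" "T k = h" using k'D by simp_all
qed

lemma eigenvalue_real:
  assumes f: "f \<in> l2_eigenspace D T z" and nz: "f \<noteq> (\<lambda>x. 0)"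
  shows "z = complex_of_real (Re z)"
proof -
  have fD: "f \<in> D" and Tf: "T f = (\<lambda>x. z * f x)" using f by (auto simp: l2_eigenspace_def)
  have "z * l2_inner f f = cnj z * l2_inner f f"
    using symmetric[OF fD fD] unfolding Tf l2_inner_cmult_left l2_inner_cmult_right .
  then have "z = cnj z"
    using nz l2_norm_eq_0_iff[OF D_l2[OF fD]] by (auto simp: l2_inner_self[OF D_l2[OF fD]])
  then show ?thesis by (simp add: complex_eq_iff)
qed

lemma eigenvalue_in_spectrum:
  assumes "f \<in> l2_eigenspace D T z" "f \<noteq> (\<lambda>x. 0)"
  shows "z \<in> l2_spectrum D T"
proof -
  have "\<not> inj_on (\<lambda>f x. T f x - z * f x) D"
    using assms zero_in_D T_zero by (force simp: inj_on_def l2_eigenspace_def)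
  then show ?thesis by (auto simp: l2_spectrum_def l2_resolvent_set_def bij_betw_def)
qed

text \<open>If \<open>T - z\<close> is bounded below, its range is closed because \<open>T\<close> is closed, and the orthogonal
  complement of its range is the kernel of \<open>T - cnj z\<close>. This kernel is trivial: eigenvalues are real,
  so it could only be the kernel of the injective operator \<open>T - z\<close>.\<close>

lemma resolventI:
  assumes C: "\<And>f. f \<in> D \<Longrightarrow> l2_norm f \<le> C * l2_norm (\<lambda>x. T f x - z * f x)"
  shows "z \<in> l2_resolvent_set D T"
proof -
  define P where "P = (\<lambda>f x. T f x - z * f x)"
  have C': "l2_norm f \<le> C * l2_norm (P f)" if "f \<in> D" for f
    using C[OF that] by (simp add: P_def)
  have Pl2: "P f \<in> l2" if "f \<in> D" for f
    unfolding P_def using that by (rule minus_scalar_l2)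
  have Pdiff: "P (\<lambda>x. f x - g x) = (\<lambda>x. P f x - P g x)" if "f \<in> D" "g \<in> D" for f g
    unfolding P_def T_diff[OF that] by (simp add: algebra_simps)
  have Padd: "P (\<lambda>x. f x + g x) = (\<lambda>x. P f x + P g x)" if "f \<in> D" "g \<in> D" for f g
    unfolding P_def T_add[OF that] by (simp add: algebra_simps)
  have Pcmult: "P (\<lambda>x. a * f x) = (\<lambda>x. a * P f x)" if "f \<in> D" for f a
    unfolding P_def T_cmult[OF that] by (simp add: algebra_simps)
  have ker: "f = (\<lambda>x. 0)" if f: "f \<in> D" and Tf: "T f = (\<lambda>x. cnj z * f x)" for f
  proof (rule ccontr)
    assume "f \<noteq> (\<lambda>x. 0)"
    moreover have "f \<in> l2_eigenspace D T (cnj z)" using f Tf by (simp add: l2_eigenspace_def)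
    ultimately have "cnj z = z"
      using eigenvalue_real by (metis complex_cnj_cnj complex_cnj_complex_of_real)
    with Tf have "P f = (\<lambda>x. 0)" by (simp add: P_def)
    with C'[OF f] have "l2_norm f = 0" by (simp add: order.antisym)
    with \<open>f \<noteq> _\<close> show False using l2_norm_eq_0_iff[OF D_l2[OF f]] by simp
  qed
  have inj: "inj_on P D"
  proof (rule inj_onI)
    fix f g assume fg: "f \<in> D" "g \<in> D" "P f = P g"
    then have "P (\<lambda>x. f x - g x) = (\<lambda>x. 0)" by (simp add: Pdiff)
    with C'[OF D_diff[OF fg(1,2)]] have "l2_norm (\<lambda>x. f x - g x) = 0" by (simp add: order.antisym)
    with l2_norm_eq_0_iff[OF l2_diff[OF D_l2 D_l2, OF fg(1,2)]]
    show "f = g" by (simp add: fun_eq_iff)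
  qed
  have "l2_closed_subspace (P ` D)"
    unfolding l2_closed_subspace_def
  proof (intro conjI allI ballI impI)
    show "P ` D \<subseteq> l2" using Pl2 by auto
    have "P (\<lambda>x. 0) = (\<lambda>x. 0)" by (simp add: P_def T_zero)
    from this[symmetric] zero_in_D show "(\<lambda>_. 0) \<in> P ` D" by (rule image_eqI)
  next
    fix u v assume "u \<in> P ` D" "v \<in> P ` D"
    then obtain f g where "f \<in> D" "g \<in> D" and uv: "u = P f" "v = P g" by blast
    from Padd[OF this(1,2), symmetric] D_add[OF this(1,2)]
    show "(\<lambda>x. u x + v x) \<in> P ` D" unfolding uv by (rule image_eqI)
  next
    fix a u assume "u \<in> P ` D"
    then obtain f where "f \<in> D" and u: "u = P f" by blast
    from Pcmult[OF this(1), symmetric] D_cmult[OF this(1)]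
    show "(\<lambda>x. a * u x) \<in> P ` D" unfolding u by (rule image_eqI)
  next
    fix v h assume v: "\<forall>n::nat. v n \<in> P ` D" and h: "h \<in> l2" and vh: "l2_tendsto v h"
    from v obtain f where f: "\<And>n. f n \<in> D" and vP: "\<And>n. v n = P (f n)"
      unfolding image_iff by metis
    note fl2 = D_l2[OF f]
    have "l2_Cauchy v"
      by (rule l2_tendsto_imp_Cauchy[OF _ h vh]) (simp add: vP Pl2 f)
    have "l2_Cauchy f"
      unfolding l2_Cauchy_def
    proof (intro allI impI)
      fix e :: real assume e: "e > 0"
      define e' where "e' = e / (\<bar>C\<bar> + 1)"
      have "e' > 0" using e by (simp add: e'_def add_nonneg_pos)
      then obtain N where N: "\<And>m n. m \<ge> N \<Longrightarrow> n \<ge> N \<Longrightarrow> l2_norm (\<lambda>x. v m x - v n x) < e'"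
        using \<open>l2_Cauchy v\<close> unfolding l2_Cauchy_def by blast
      show "\<exists>N. \<forall>m\<ge>N. \<forall>n\<ge>N. l2_norm (\<lambda>x. f m x - f n x) < e"
      proof (intro exI allI impI)
        fix m n assume "m \<ge> N" "n \<ge> N"
        have "l2_norm (\<lambda>x. f m x - f n x) \<le> C * l2_norm (\<lambda>x. v m x - v n x)"
          using C'[OF D_diff[OF f f], of m n] by (simp add: Pdiff f vP)
        also have "\<dots> \<le> (\<bar>C\<bar> + 1) * l2_norm (\<lambda>x. v m x - v n x)"
          by (intro mult_right_mono) auto
        also have "\<dots> < (\<bar>C\<bar> + 1) * e'"
          using N[OF \<open>m \<ge> N\<close> \<open>n \<ge> N\<close>] by (intro mult_strict_left_mono) auto
        also have "\<dots> = e" by (simp add: e'_def add_nonneg_pos)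
        finally show "l2_norm (\<lambda>x. f m x - f n x) < e" .
      qed
    qed
    then obtain g where g: "g \<in> l2" and fg: "l2_tendsto f g"
      using l2_complete[of f] fl2 by blast
    have "l2_tendsto (\<lambda>n. T (f n)) (\<lambda>x. h x + z * g x)"
    proof (rule Lim_null_comparison)
      show "(\<lambda>n. l2_norm (\<lambda>x. v n x - h x) + cmod z * l2_norm (\<lambda>x. f n x - g x)) \<longlonglongrightarrow> 0"
        by (intro tendsto_add_zero tendsto_mult_right_zero vh fg)
      have "l2_norm (\<lambda>x. T (f n) x - (h x + z * g x)) \<le>
          l2_norm (\<lambda>x. v n x - h x) + cmod z * l2_norm (\<lambda>x. f n x - g x)" for n
      proof -
        have "(\<lambda>x. T (f n) x - (h x + z * g x)) = (\<lambda>x. (v n x - h x) + z * (f n x - g x))"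
          by (auto simp: vP P_def algebra_simps)
        moreover have "l2_norm (\<lambda>x. (v n x - h x) + z * (f n x - g x)) \<le>
            l2_norm (\<lambda>x. v n x - h x) + l2_norm (\<lambda>x. z * (f n x - g x))"
          by (intro l2_norm_triangle l2_diff l2_cmult fl2 g h) (simp add: vP Pl2 f)
        ultimately show ?thesis by (simp add: l2_norm_cmult)
      qed
      then show "\<forall>\<^sub>F n in sequentially. norm (l2_norm (\<lambda>x. T (f n) x - (h x + z * g x))) \<le>
          l2_norm (\<lambda>x. v n x - h x) + cmod z * l2_norm (\<lambda>x. f n x - g x)"
        by simp
    qed
    note lim = graph_closed[OF f g l2_add[OF h l2_cmult[OF g]] fg this]
    then have "h = P g" by (simp add: P_def)
    with lim(1) show "h \<in> P ` D" by simp
  qed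
  note closed = this
  have "h \<in> P ` D" if h: "h \<in> l2" for h
  proof -
    obtain p where p: "p \<in> P ` D"
      and orth: "\<And>m. m \<in> P ` D \<Longrightarrow> l2_inner (\<lambda>x. h x - p x) m = 0"
      using l2_orthogonal_projection[OF closed h] by blast
    define k where "k = (\<lambda>x. h x - p x)"
    have k: "k \<in> l2" unfolding k_def using p h Pl2 by (auto intro: l2_diff)
    have "l2_inner (T f) k = l2_inner f (\<lambda>x. cnj z * k x)" if f: "f \<in> D" for f
    proof -
      have "l2_inner (P f) k = 0"
        using orth[of "P f"] f l2_inner_commute[of "P f" k] by (simp add: k_def)
      then show ?thesis
        unfolding P_def
        by (simp add: l2_inner_diff_left[OF T_l2[OF f] l2_cmult[OF D_l2[OF f]] k]
            l2_inner_cmult_left l2_inner_cmult_right)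
    qed
    from adjoint_domain[OF k l2_cmult[OF k] this] have "k = (\<lambda>x. 0)" by (intro ker)
    then have "h = p" by (simp add: k_def fun_eq_iff)
    with p show ?thesis by simp
  qed
  with Pl2 have "P ` D = l2" by auto
  with inj have "bij_betw P D l2" by (simp add: bij_betw_def)
  with C show ?thesis unfolding l2_resolvent_set_def P_def by blast
qed

end

text \<open>Convergence on a finite set is all that compactness has to provide: outside of a suitable finite
  set, functions will be controlled by the potential.\<close>

lemma subsequence_converging_on_finite_set:
  fixes f :: "nat \<Rightarrow> 'i \<Rightarrow> complex"
  assumes "finite K" and bounded: "\<And>n x. cmod (f n x) \<le> B"
  obtains r where "strict_mono (r :: nat \<Rightarrow> nat)" "\<And>x. x \<in> K \<Longrightarrow> convergent (\<lambda>n. f (r n) x)"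
proof -
  have "\<exists>r. strict_mono (r :: nat \<Rightarrow> nat) \<and> (\<forall>x\<in>K. convergent (\<lambda>n. f (r n) x))"
    using \<open>finite K\<close>
  proof (induction K rule: finite_induct)
    case empty
    show ?case by (rule exI[of _ id]) (auto simp: strict_mono_def)
  next
    case (insert k K)
    then obtain r where r: "strict_mono r" "\<forall>x\<in>K. convergent (\<lambda>n. f (r n) x)" by blast
    have "Bseq (\<lambda>n. f (r n) k)" by (rule BseqI'[of _ B]) (rule bounded)
    then have "bounded (range (\<lambda>n. f (r n) k))" by (simp add: Bseq_eq_bounded)
    then obtain l s where s: "strict_mono (s :: nat \<Rightarrow> nat)" "((\<lambda>n. f (r n) k) \<circ> s) \<longlonglongrightarrow> l"
      using bounded_imp_convergent_subsequence by blast
    have "convergent (\<lambda>n. f ((r \<circ> s) n) x)" if "x \<in> insert k K" for x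
    proof (cases "x = k")
      case True
      with s(2) show ?thesis by (auto simp: convergent_def o_def)
    next
      case False
      with that r(2) have "convergent (\<lambda>n. f (r n) x)" by simp
      from convergent_subseq_convergent[OF this s(1)] show ?thesis by (simp add: o_def)
    qed
    with r(1) s(1) show ?case using strict_mono_o by blast
  qed
  then show ?thesis using that by blast
qed

lemma subsequence_Cauchy_on_finite_set:
  fixes f :: "nat \<Rightarrow> 'i \<Rightarrow> complex"
  assumes "finite K" "\<And>n x. cmod (f n x) \<le> B"
  obtains r where "strict_mono (r :: nat \<Rightarrow> nat)"
    "\<And>e. e > 0 \<Longrightarrow> \<exists>N. \<forall>m\<ge>N. \<forall>n\<ge>N. (\<Sum>x\<in>K. (cmod (f (r m) x - f (r n) x))\<^sup>2) < e"
proof -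
  obtain r where r: "strict_mono r" "\<And>x. x \<in> K \<Longrightarrow> convergent (\<lambda>n. f (r n) x)"
    using subsequence_converging_on_finite_set[where f = f and B = B, OF assms] by blast
  define l where "l x = lim (\<lambda>n. f (r n) x)" for x
  define s where "s n = (\<Sum>x\<in>K. (cmod (f (r n) x - l x))\<^sup>2)" for n
  have "(\<lambda>n. f (r n) x) \<longlonglongrightarrow> l x" if "x \<in> K" for x
    using r(2)[OF that] unfolding l_def by (simp add: convergent_LIMSEQ_iff)
  then have "s \<longlonglongrightarrow> (\<Sum>x\<in>K. (cmod (l x - l x))\<^sup>2)"
    unfolding s_def by (intro tendsto_sum tendsto_power tendsto_norm tendsto_diff tendsto_const)
  then have s0: "s \<longlonglongrightarrow> 0" by simp
  have bound: "(\<Sum>x\<in>K. (cmod (f (r m) x - f (r n) x))\<^sup>2) \<le> 2 * s m + 2 * s n" for m n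
  proof -
    have "(cmod (a - c))\<^sup>2 \<le> 2 * (cmod (a - d))\<^sup>2 + 2 * (cmod (c - d))\<^sup>2" for a c d :: complex
    proof -
      have "cmod (a - c) \<le> cmod (a - d) + cmod (c - d)"
        using norm_triangle_ineq4[of "a - d" "c - d"] by simp
      then have "(cmod (a - c))\<^sup>2 \<le> (cmod (a - d) + cmod (c - d))\<^sup>2" by (simp add: power_mono)
      also have "\<dots> \<le> 2 * (cmod (a - d))\<^sup>2 + 2 * (cmod (c - d))\<^sup>2"
        using sum_squares_bound[of "cmod (a - d)" "cmod (c - d)"] by (simp add: power2_sum)
      finally show ?thesis .
    qed
    then show ?thesis
      unfolding s_def sum_distrib_left sum.distrib[symmetric] by (intro sum_mono)
  qed
  have "\<exists>N. \<forall>m\<ge>N. \<forall>n\<ge>N. (\<Sum>x\<in>K. (cmod (f (r m) x - f (r n) x))\<^sup>2) < e" if "e > 0" for e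
  proof -
    obtain N where N: "\<And>n. n \<ge> N \<Longrightarrow> \<bar>s n\<bar> < e / 4"
      using LIMSEQ_D[OF s0, of "e / 4"] \<open>e > 0\<close> by auto
    have "(\<Sum>x\<in>K. (cmod (f (r m) x - f (r n) x))\<^sup>2) < e" if "m \<ge> N" "n \<ge> N" for m n
      using bound[of m n] N[OF that(1)] N[OF that(2)] by linarith
    then show ?thesis by blast
  qed
  with r(1) show ?thesis by (rule that)
qed

text \<open>Gaussian elimination, one point \<open>k\<close> at a time: modulo a single \<open>f0\<close> with \<open>f0 k \<noteq> 0\<close>, every
  element of \<open>E\<close> vanishes at \<open>k\<close>.\<close>

lemma finite_dim_if_determined_on_finite_set:
  assumes "finite K"
    and "\<And>f g. f \<in> E \<Longrightarrow> g \<in> E \<Longrightarrow> (\<lambda>x. f x + g x) \<in> E"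
    and "\<And>a f. f \<in> E \<Longrightarrow> (\<lambda>x. a * f x) \<in> E"
    and "\<And>f. f \<in> E \<Longrightarrow> (\<And>x. x \<in> K \<Longrightarrow> f x = 0) \<Longrightarrow> f = (\<lambda>x. 0)"
  shows "finite_dim E"
  using assms
proof (induction K arbitrary: E rule: finite_induct)
  case empty
  show ?case unfolding finite_dim_def by (rule exI[of _ "{}"]) (use empty.prems(3) in auto)
next
  case (insert k K)
  define E' where "E' = {f \<in> E. f k = 0}"
  have "finite_dim E'"
  proof (rule insert.IH)
    show "(\<lambda>x. f x + g x) \<in> E'" if "f \<in> E'" "g \<in> E'" for f g
      using that insert.prems(1) by (simp add: E'_def)
    show "(\<lambda>x. a * f x) \<in> E'" if "f \<in> E'" for a f
      using that insert.prems(2) by (simp add: E'_def)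
    show "f = (\<lambda>x. 0)" if "f \<in> E'" "\<And>x. x \<in> K \<Longrightarrow> f x = 0" for f
      using that insert.prems(3)[of f] by (auto simp: E'_def)
  qed
  then obtain B where B: "finite B" "\<And>f. f \<in> E' \<Longrightarrow> \<exists>c. f = (\<lambda>x. \<Sum>g\<in>B. c g * g x)"
    unfolding finite_dim_def by blast
  show ?case
  proof (cases "\<exists>f0\<in>E. f0 k \<noteq> 0")
    case False
    then have "E = E'" by (auto simp: E'_def)
    with \<open>finite_dim E'\<close> show ?thesis by simp
  next
    case True
    then obtain f0 where f0: "f0 \<in> E" "f0 k \<noteq> 0" by blast
    have "\<exists>c. f = (\<lambda>x. \<Sum>g\<in>insert f0 B. c g * g x)" if f: "f \<in> E" for f
    proof -
      define a where "a = f k / f0 k"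
      have "(\<lambda>x. f x + (- a) * f0 x) \<in> E" using f f0 insert.prems(1,2) by blast
      then have "(\<lambda>x. f x + (- a) * f0 x) \<in> E'" using f0 by (simp add: E'_def a_def)
      from B(2)[OF this] obtain c where "(\<lambda>x. f x + (- a) * f0 x) = (\<lambda>x. \<Sum>g\<in>B. c g * g x)"
        by blast
      then have c: "f x = (\<Sum>g\<in>B. c g * g x) + a * f0 x" for x
        by (metis (no_types, lifting) add.commute add.right_inverse add_diff_cancel_left'
            diff_minus_eq_add minus_mult_left)
      \<comment> \<open>The sum covers the case that \<open>f0\<close> already belongs to \<open>B\<close>.\<close>
      define c' where "c' g = (if g \<in> B then c g else 0) + (if g = f0 then a else 0)" for g
      have "(\<Sum>g\<in>insert f0 B. c' g * g x) = (\<Sum>g\<in>B. c g * g x) + a * f0 x" for x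
      proof -
        have "(\<Sum>g\<in>insert f0 B. c' g * g x) =
            (\<Sum>g\<in>insert f0 B. (if g \<in> B then c g * g x else 0)) +
            (\<Sum>g\<in>insert f0 B. (if g = f0 then a * f0 x else 0))"
          unfolding sum.distrib[symmetric]
          by (intro sum.cong) (auto simp: c'_def distrib_right)
        also have "(\<Sum>g\<in>insert f0 B. (if g \<in> B then c g * g x else 0)) = (\<Sum>g\<in>B. c g * g x)"
          using B(1) by (intro sum.mono_neutral_cong_right) auto
        also have "(\<Sum>g\<in>insert f0 B. (if g = f0 then a * f0 x else 0)) = a * f0 x"
          using B(1) by (subst sum.delta) auto
        finally show ?thesis .
      qed
      with c have "f = (\<lambda>x. \<Sum>g\<in>insert f0 B. c' g * g x)" by (simp add: fun_eq_iff)
      then show ?thesis by blast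
    qed
    with B(1) show ?thesis unfolding finite_dim_def by (intro exI[of _ "insert f0 B"]) auto
  qed
qed

text \<open>The form bound is stated with finite partial sums, so that it contains no claim of summability
  and is preserved by pointwise limits.\<close>

locale confined_operator = nonneg_selfadjoint_operator D T
  for D :: "('i \<Rightarrow> complex) set" and T :: "('i \<Rightarrow> complex) \<Rightarrow> ('i \<Rightarrow> complex)" +
  fixes w :: "'i \<Rightarrow> real" and c :: real
  assumes c_pos: "0 < c" and c_le_w: "c \<le> w x"
    and finite_sublevel: "finite {x. w x \<le> L}"
    and potential_bound: "f \<in> D \<Longrightarrow> finite F \<Longrightarrow>
      (\<Sum>x\<in>F. w x * (cmod (f x))\<^sup>2) \<le> Re (l2_inner (T f) f)"
begin

lemma quadratic_form_lower_bound:
  assumes f: "f \<in> D"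
  shows "c * (l2_norm f)\<^sup>2 \<le> Re (l2_inner (T f) f)"
proof -
  have "(\<Sum>x\<in>F. (cmod (f x))\<^sup>2) \<le> Re (l2_inner (T f) f) / c" if F: "finite F" for F
  proof -
    have "c * (\<Sum>x\<in>F. (cmod (f x))\<^sup>2) \<le> (\<Sum>x\<in>F. w x * (cmod (f x))\<^sup>2)"
      unfolding sum_distrib_left by (intro sum_mono mult_right_mono c_le_w) auto
    also have "\<dots> \<le> Re (l2_inner (T f) f)" by (rule potential_bound[OF f F])
    finally show ?thesis using c_pos by (simp add: field_simps)
  qed
  from l2_bounded_partial_sums(2)[OF this] show ?thesis using c_pos by (simp add: field_simps)
qed

text \<open>Where the potential exceeds \<open>L\<close> it absorbs \<open>L * (cmod (f x))\<^sup>2\<close>; the finitely many other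
  points are paid for explicitly.\<close>

lemma confinement:
  assumes f: "f \<in> D" and L: "0 < L"
  shows "L * (l2_norm f)\<^sup>2 \<le> Re (l2_inner (T f) f) + L * (\<Sum>x | w x \<le> L. (cmod (f x))\<^sup>2)"
proof -
  define K where "K = {x. w x \<le> L}"
  have K: "finite K" unfolding K_def by (rule finite_sublevel)
  have "(\<Sum>x\<in>F. (cmod (f x))\<^sup>2) \<le> (Re (l2_inner (T f) f) + L * (\<Sum>x\<in>K. (cmod (f x))\<^sup>2)) / L"
    if F: "finite F" for F
  proof -
    have "L * (\<Sum>x\<in>F. (cmod (f x))\<^sup>2) \<le>
        (\<Sum>x\<in>F. w x * (cmod (f x))\<^sup>2 + (if x \<in> K then L * (cmod (f x))\<^sup>2 else 0))"
      unfolding sum_distrib_left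
    proof (rule sum_mono)
      fix x
      have "0 \<le> w x * (cmod (f x))\<^sup>2" using c_le_w[of x] c_pos by simp
      moreover have "L * (cmod (f x))\<^sup>2 \<le> w x * (cmod (f x))\<^sup>2" if "x \<notin> K"
        using that by (intro mult_right_mono) (auto simp: K_def)
      ultimately show "L * (cmod (f x))\<^sup>2 \<le>
          w x * (cmod (f x))\<^sup>2 + (if x \<in> K then L * (cmod (f x))\<^sup>2 else 0)" by auto
    qed
    also have "\<dots> = (\<Sum>x\<in>F. w x * (cmod (f x))\<^sup>2) + (\<Sum>x\<in>F \<inter> K. L * (cmod (f x))\<^sup>2)"
      unfolding sum.distrib sum.inter_restrict[OF F] ..
    also have "\<dots> \<le> Re (l2_inner (T f) f) + (\<Sum>x\<in>K. L * (cmod (f x))\<^sup>2)"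
      using L K by (intro add_mono potential_bound f F sum_mono2) auto
    also have "\<dots> = Re (l2_inner (T f) f) + L * (\<Sum>x\<in>K. (cmod (f x))\<^sup>2)"
      by (simp add: sum_distrib_left)
    finally show ?thesis using L by (simp add: field_simps)
  qed
  from l2_bounded_partial_sums(2)[OF this] show ?thesis
    unfolding K_def using L by (simp add: field_simps)
qed

lemma eigenvalue_ge:
  assumes f: "f \<in> l2_eigenspace D T z" and nz: "f \<noteq> (\<lambda>x. 0)"
  shows "c \<le> Re z"
proof -
  have fD: "f \<in> D" and Tf: "T f = (\<lambda>x. z * f x)" using f by (auto simp: l2_eigenspace_def)
  have "c * (l2_norm f)\<^sup>2 \<le> Re z * (l2_norm f)\<^sup>2"
    using quadratic_form_lower_bound[OF fD]
    unfolding Tf l2_inner_cmult_left l2_inner_self[OF D_l2[OF fD]] by simp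
  moreover have "0 < (l2_norm f)\<^sup>2"
    using nz l2_norm_eq_0_iff[OF D_l2[OF fD]] by simp
  ultimately show ?thesis by simp
qed

text \<open>By \<open>confinement\<close>, an eigenfunction that vanishes on a large sublevel set of the potential is
  zero.\<close>

lemma eigenspace_finite_dim: "finite_dim (l2_eigenspace D T z)"
proof (rule finite_dim_if_determined_on_finite_set)
  define L where "L = cmod z + 1"
  have L: "0 < L" by (simp add: L_def add_nonneg_pos)
  show "finite {x. w x \<le> L}" by (rule finite_sublevel)
  show "(\<lambda>x. f x + g x) \<in> l2_eigenspace D T z"
    if "f \<in> l2_eigenspace D T z" "g \<in> l2_eigenspace D T z" for f g
    using that by (auto simp: l2_eigenspace_def D_add T_add distrib_left)
  show "(\<lambda>x. a * f x) \<in> l2_eigenspace D T z" if "f \<in> l2_eigenspace D T z" for a f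
    using that by (auto simp: l2_eigenspace_def D_cmult T_cmult)
  show "f = (\<lambda>x. 0)"
    if "f \<in> l2_eigenspace D T z" "\<And>x. x \<in> {x. w x \<le> L} \<Longrightarrow> f x = 0" for f
  proof -
    have fD: "f \<in> D" and Tf: "T f = (\<lambda>x. z * f x)" using that(1) by (auto simp: l2_eigenspace_def)
    have "L * (l2_norm f)\<^sup>2 \<le> Re z * (l2_norm f)\<^sup>2"
      using confinement[OF fD L] that(2)
      unfolding Tf l2_inner_cmult_left l2_inner_self[OF D_l2[OF fD]] by simp
    also have "\<dots> \<le> cmod z * (l2_norm f)\<^sup>2"
      by (intro mult_right_mono complex_Re_le_cmod) auto
    finally have "(l2_norm f)\<^sup>2 \<le> 0" by (simp add: L_def algebra_simps)
    then show ?thesis using l2_norm_eq_0_iff[OF D_l2[OF fD]] by simp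
  qed
qed

text \<open>Otherwise there would be normalized \<open>f n\<close> with \<open>T (f n) - z * f n\<close> tending to zero. By
  \<open>confinement\<close>, a subsequence that converges on a finite set is Cauchy; its limit would be an
  eigenfunction.\<close>

lemma bounded_below_if_not_eigenvalue:
  assumes not_ev: "\<And>f. f \<in> l2_eigenspace D T z \<Longrightarrow> f = (\<lambda>x. 0)"
  shows "\<exists>C. \<forall>f\<in>D. l2_norm f \<le> C * l2_norm (\<lambda>x. T f x - z * f x)"
proof (rule ccontr)
  define P where "P = (\<lambda>f x. T f x - z * f x)"
  assume "\<not> ?thesis"
  then have "\<exists>f\<in>D. real (Suc n) * l2_norm (P f) < l2_norm f" for n
    unfolding P_def by (meson not_le)
  then have "\<forall>n. \<exists>f. f \<in> D \<and> real (Suc n) * l2_norm (P f) < l2_norm f" by blast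
  from choice[OF this] obtain g where g: "\<And>n. g n \<in> D"
    and gP: "\<And>n. real (Suc n) * l2_norm (P (g n)) < l2_norm (g n)"
    by blast
  have gpos: "0 < l2_norm (g n)" for n
    by (rule le_less_trans[OF mult_nonneg_nonneg gP[of n]]) auto
  define f where "f n = (\<lambda>x. complex_of_real (1 / l2_norm (g n)) * g n x)" for n
  have fD: "f n \<in> D" for n unfolding f_def by (intro D_cmult g)
  note fl2 = D_l2[OF fD]
  have f1: "l2_norm (f n) = 1" for n
    using gpos[of n] unfolding f_def l2_norm_cmult by (simp add: norm_divide)
  have f_le_1: "cmod (f n x) \<le> 1" for n x
    using cmod_le_l2_norm[OF fl2, of n x] by (simp add: f1)
  have Pl2: "P h \<in> l2" if "h \<in> D" for h unfolding P_def using that by (rule minus_scalar_l2)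
  have fP: "l2_norm (P (f n)) \<le> 1 / real (Suc n)" for n
  proof -
    have "P (f n) = (\<lambda>x. complex_of_real (1 / l2_norm (g n)) * P (g n) x)"
      unfolding P_def f_def T_cmult[OF g] by (simp add: algebra_simps)
    then have "l2_norm (P (f n)) = l2_norm (P (g n)) / l2_norm (g n)"
      using gpos[of n] by (simp only: l2_norm_cmult) (simp add: norm_divide)
    also have "\<dots> \<le> 1 / real (Suc n)"
      using gP[of n] gpos[of n]
      by (simp add: pos_divide_le_eq pos_le_divide_eq mult.commute less_imp_le del: of_nat_Suc)
    finally show ?thesis .
  qed
  \<comment> \<open>For this \<open>L\<close>, \<open>confinement\<close> leaves a full \<open>(l2_norm d)\<^sup>2\<close> after \<open>cmod z * (l2_norm d)\<^sup>2\<close>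
    has been absorbed.\<close>
  define L where "L = cmod z + 1"
  have L: "0 < L" by (simp add: L_def add_nonneg_pos)
  have key: "(l2_norm (\<lambda>x. f m x - f n x))\<^sup>2 \<le>
      2 / real (Suc m) + 2 / real (Suc n) + L * (\<Sum>x | w x \<le> L. (cmod (f m x - f n x))\<^sup>2)" for m n
  proof -
    define d where "d = (\<lambda>x. f m x - f n x)"
    have dD: "d \<in> D" unfolding d_def by (intro D_diff fD)
    note dl2 = D_l2[OF dD]
    have "l2_norm (P d) \<le> l2_norm (P (f m)) + l2_norm (P (f n))"
    proof -
      have "P d = (\<lambda>x. P (f m) x - P (f n) x)"
        unfolding P_def d_def T_diff[OF fD fD] by (simp add: algebra_simps)
      then show ?thesis using l2_norm_triangle_diff[OF Pl2[OF fD] Pl2[OF fD]] by simp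
    qed
    then have Pd: "l2_norm (P d) \<le> 1 / real (Suc m) + 1 / real (Suc n)"
      using fP[of m] fP[of n] by linarith
    have d2: "l2_norm d \<le> 2"
      using l2_norm_triangle_diff[OF fl2 fl2, of m n] by (simp add: d_def f1)
    have "T d = (\<lambda>x. P d x + z * d x)" by (simp add: P_def)
    then have "l2_inner (T d) d = l2_inner (P d) d + z * complex_of_real ((l2_norm d)\<^sup>2)"
      using l2_inner_add_left[OF Pl2[OF dD] l2_cmult[OF dl2] dl2, of z]
      by (simp add: l2_inner_cmult_left l2_inner_self[OF dl2])
    then have "Re (l2_inner (T d) d) = Re (l2_inner (P d) d) + Re z * (l2_norm d)\<^sup>2"
      by (simp del: of_real_power)
    also have "\<dots> \<le> l2_norm (P d) * l2_norm d + cmod z * (l2_norm d)\<^sup>2"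
      using l2_cauchy_schwarz[OF Pl2[OF dD] dl2] complex_Re_le_cmod[of "l2_inner (P d) d"]
      by (intro add_mono mult_right_mono complex_Re_le_cmod) auto
    also have "l2_norm (P d) * l2_norm d \<le> (1 / real (Suc m) + 1 / real (Suc n)) * 2"
      using Pd d2 by (intro mult_mono) auto
    finally have "Re (l2_inner (T d) d) \<le>
        2 / real (Suc m) + 2 / real (Suc n) + cmod z * (l2_norm d)\<^sup>2" by simp
    with confinement[OF dD L] have "(l2_norm d)\<^sup>2 \<le>
        2 / real (Suc m) + 2 / real (Suc n) + L * (\<Sum>x | w x \<le> L. (cmod (d x))\<^sup>2)"
      by (simp add: L_def algebra_simps)
    then show ?thesis by (simp add: d_def)
  qed
  obtain r where r: "strict_mono (r :: nat \<Rightarrow> nat)"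
    and rK: "\<And>e. e > 0 \<Longrightarrow>
      \<exists>N. \<forall>m\<ge>N. \<forall>n\<ge>N. (\<Sum>x | w x \<le> L. (cmod (f (r m) x - f (r n) x))\<^sup>2) < e"
    using subsequence_Cauchy_on_finite_set[where f = f and B = 1, OF finite_sublevel[of L] f_le_1]
    by blast
  define h where "h n = f (r n)" for n
  have hD: "h n \<in> D" for n by (simp add: h_def fD)
  note hl2 = D_l2[OF hD]
  have "l2_Cauchy h"
    unfolding l2_Cauchy_def
  proof (intro allI impI)
    fix e :: real assume e: "e > 0"
    obtain N1 where N1: "\<And>m n. m \<ge> N1 \<Longrightarrow> n \<ge> N1 \<Longrightarrow>
        (\<Sum>x | w x \<le> L. (cmod (h m x - h n x))\<^sup>2) < e\<^sup>2 / (2 * L)"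
      using rK[of "e\<^sup>2 / (2 * L)"] e L by (auto simp: h_def)
    obtain N2 where N2: "8 / e\<^sup>2 < real N2" using reals_Archimedean2 by blast
    have small: "2 / real (Suc (r k)) < e\<^sup>2 / 4" if "k \<ge> N2" for k
    proof -
      have "real N2 \<le> real (Suc (r k))"
        using that strict_mono_imp_increasing[OF r, of k] by simp
      with N2 have "8 / e\<^sup>2 < real (Suc (r k))" by linarith
      then have "8 < real (Suc (r k)) * e\<^sup>2" using e by (simp add: divide_less_eq)
      then show ?thesis by (simp add: field_simps)
    qed
    show "\<exists>N. \<forall>m\<ge>N. \<forall>n\<ge>N. l2_norm (\<lambda>x. h m x - h n x) < e"
    proof (intro exI allI impI)
      fix m n assume "m \<ge> max N1 N2" "n \<ge> max N1 N2"
      then have mn: "m \<ge> N1" "m \<ge> N2" "n \<ge> N1" "n \<ge> N2" by auto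
      have "L * (\<Sum>x | w x \<le> L. (cmod (h m x - h n x))\<^sup>2) < L * (e\<^sup>2 / (2 * L))"
        using N1[OF mn(1,3)] L by (rule mult_strict_left_mono)
      also have "\<dots> = e\<^sup>2 / 2" using L by simp
      finally have "(l2_norm (\<lambda>x. h m x - h n x))\<^sup>2 < e\<^sup>2"
        using key[of "r m" "r n"] small[OF mn(2)] small[OF mn(4)] by (simp add: h_def)
      then show "l2_norm (\<lambda>x. h m x - h n x) < e" using e by (simp add: power2_less_imp_less)
    qed
  qed
  then obtain l where l: "l \<in> l2" and hl: "l2_tendsto h l"
    using l2_complete[of h] hl2 by blast
  have "(\<lambda>n. l2_norm (h n)) \<longlonglongrightarrow> l2_norm l" by (rule l2_tendsto_norm[OF hl2 l hl])
  then have l1: "l2_norm l = 1" by (simp add: h_def f1 LIMSEQ_const_iff)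
  have "l2_tendsto (\<lambda>n. T (h n)) (\<lambda>x. z * l x)"
  proof (rule Lim_null_comparison)
    show "(\<lambda>n. 1 / real (Suc n) + cmod z * l2_norm (\<lambda>x. h n x - l x)) \<longlonglongrightarrow> 0"
      by (intro tendsto_add_zero tendsto_mult_right_zero hl LIMSEQ_Suc[OF lim_1_over_n])
    have "l2_norm (\<lambda>x. T (h n) x - z * l x) \<le> 1 / real (Suc n) + cmod z * l2_norm (\<lambda>x. h n x - l x)" for n
    proof -
      have "(\<lambda>x. T (h n) x - z * l x) = (\<lambda>x. P (h n) x + z * (h n x - l x))"
        by (auto simp: P_def algebra_simps)
      then have "l2_norm (\<lambda>x. T (h n) x - z * l x) \<le>
          l2_norm (P (h n)) + cmod z * l2_norm (\<lambda>x. h n x - l x)"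
        using l2_norm_triangle[OF Pl2[OF hD] l2_cmult[OF l2_diff[OF hl2 l]]]
        by (simp add: l2_norm_cmult)
      moreover have "l2_norm (P (h n)) \<le> 1 / real (Suc (r n))" unfolding h_def by (rule fP)
      moreover have "1 / real (Suc (r n)) \<le> 1 / real (Suc n)"
        using strict_mono_imp_increasing[OF r, of n] by (simp add: field_simps)
      ultimately show ?thesis by linarith
    qed
    then show "\<forall>\<^sub>F n in sequentially. norm (l2_norm (\<lambda>x. T (h n) x - z * l x)) \<le>
        1 / real (Suc n) + cmod z * l2_norm (\<lambda>x. h n x - l x)" by simp
  qed
  from graph_closed[OF hD l l2_cmult[OF l] hl this]
  have "l \<in> l2_eigenspace D T z" by (simp add: l2_eigenspace_def)
  then have "l = (\<lambda>x. 0)" by (rule not_ev)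
  with l1 show False by simp
qed

lemma spectrum_eq_eigenvalues:
  "l2_spectrum D T = {z. \<exists>f\<in>l2_eigenspace D T z. f \<noteq> (\<lambda>x. 0)}"
proof (intro equalityI subsetI)
  fix z assume "z \<in> l2_spectrum D T"
  then have "z \<notin> l2_resolvent_set D T" by (simp add: l2_spectrum_def)
  then show "z \<in> {z. \<exists>f\<in>l2_eigenspace D T z. f \<noteq> (\<lambda>x. 0)}"
    using resolventI bounded_below_if_not_eigenvalue by blast
qed (auto intro: eigenvalue_in_spectrum)

text \<open>Eigenfunctions to distinct eigenvalues are orthogonal, so the differences of normalized ones
  have norm \<open>sqrt 2\<close>; if infinitely many eigenvalues had real part at most \<open>L\<close>, then
  \<open>confinement\<close> would keep these differences away from zero on a fixed finite set.\<close>

lemma finitely_many_eigenvalues: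
  assumes L: "0 < L"
  shows "finite {z \<in> l2_spectrum D T. Re z \<le> L}"
proof (rule ccontr)
  assume "infinite {z \<in> l2_spectrum D T. Re z \<le> L}"
  then obtain z :: "nat \<Rightarrow> complex" where inj: "inj z"
    and z: "range z \<subseteq> {z \<in> l2_spectrum D T. Re z \<le> L}"
    using infinite_countable_subset by blast
  then have "\<forall>n. \<exists>g. g \<in> l2_eigenspace D T (z n) \<and> g \<noteq> (\<lambda>x. 0)"
    unfolding spectrum_eq_eigenvalues by blast
  from choice[OF this] obtain g
    where g: "\<And>n. g n \<in> l2_eigenspace D T (z n)" and g0: "\<And>n. g n \<noteq> (\<lambda>x. 0)"
    by blast
  have gD: "g n \<in> D" and Tg: "T (g n) = (\<lambda>x. z n * g n x)" for n
    using g[of n] by (auto simp: l2_eigenspace_def)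
  have gpos: "l2_norm (g n) \<noteq> 0" for n using l2_norm_eq_0_iff[OF D_l2[OF gD]] g0 by simp
  define f where "f n = (\<lambda>x. complex_of_real (1 / l2_norm (g n)) * g n x)" for n
  have fD: "f n \<in> D" for n unfolding f_def by (intro D_cmult gD)
  note fl2 = D_l2[OF fD]
  have Tf: "T (f n) = (\<lambda>x. z n * f n x)" for n
    unfolding f_def T_cmult[OF gD] Tg by (simp add: algebra_simps)
  have f1: "l2_norm (f n) = 1" for n
    using gpos[of n] unfolding f_def l2_norm_cmult by (simp add: norm_divide)
  have f_le_1: "cmod (f n x) \<le> 1" for n x
    using cmod_le_l2_norm[OF fl2, of n x] by (simp add: f1)
  have zr: "cnj (z n) = z n" for n
    using eigenvalue_real[OF g g0, of n] by (metis complex_cnj_complex_of_real)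
  have zL: "Re (z n) \<le> L" for n using z by auto
  have orth: "l2_inner (f m) (f n) = 0" if "m \<noteq> n" for m n
  proof -
    have "z m * l2_inner (f m) (f n) = z n * l2_inner (f m) (f n)"
      using symmetric[OF fD fD, of m n] unfolding Tf l2_inner_cmult_left l2_inner_cmult_right zr .
    moreover have "z m \<noteq> z n" using inj that by (auto dest: injD)
    ultimately show ?thesis by simp
  qed
  \<comment> \<open>The form is at most \<open>2 * L\<close> at a difference \<open>d\<close>, and \<open>(l2_norm d)\<^sup>2 = 2\<close>; so \<open>confinement\<close>
    has to be used at the level \<open>2 * L\<close> to leave something for the finite set.\<close>
  have far: "(\<Sum>x | w x \<le> 2 * L. (cmod (f m x - f n x))\<^sup>2) \<ge> 1" if mn: "m \<noteq> n" for m n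
  proof -
    define d where "d = (\<lambda>x. f m x - f n x)"
    have dD: "d \<in> D" unfolding d_def by (intro D_diff fD)
    have d2: "(l2_norm d)\<^sup>2 = 2"
      unfolding d_def l2_norm_diff_square[OF fl2 fl2] using orth[OF mn] by (simp add: f1)
    have Td: "T d = (\<lambda>x. z m * f m x - z n * f n x)" unfolding d_def T_diff[OF fD fD] Tf ..
    have nm: "l2_inner (f n) (f m) = 0" using orth mn by simp
    have "l2_inner (T d) d = z m + z n"
      unfolding Td unfolding d_def
      by (simp add: l2_inner_diff_left l2_inner_diff_right fl2 l2_cmult l2_diff l2_inner_cmult_left
          orth[OF mn] nm l2_inner_self[OF fl2] f1)
    then have "Re (l2_inner (T d) d) \<le> 2 * L" using zL[of m] zL[of n] by simp
    with confinement[OF dD, of "2 * L"] L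
    have "L * 1 \<le> L * (\<Sum>x | w x \<le> 2 * L. (cmod (d x))\<^sup>2)"
      unfolding d2 by linarith
    with L show ?thesis by (simp only: d_def mult_le_cancel_left_pos)
  qed
  obtain r where r: "strict_mono (r :: nat \<Rightarrow> nat)"
    and rK: "\<And>e. e > 0 \<Longrightarrow>
      \<exists>N. \<forall>m\<ge>N. \<forall>n\<ge>N. (\<Sum>x | w x \<le> 2 * L. (cmod (f (r m) x - f (r n) x))\<^sup>2) < e"
    using subsequence_Cauchy_on_finite_set[where f = f and B = 1,
        OF finite_sublevel[of "2 * L"] f_le_1]
    by blast
  obtain N where "\<And>m n. m \<ge> N \<Longrightarrow> n \<ge> N \<Longrightarrow>
      (\<Sum>x | w x \<le> 2 * L. (cmod (f (r m) x - f (r n) x))\<^sup>2) < 1"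
    using rK[of 1] by auto
  from this[of N "Suc N"] have "(\<Sum>x | w x \<le> 2 * L. (cmod (f (r N) x - f (r (Suc N)) x))\<^sup>2) < 1"
    by simp
  moreover have "r N \<noteq> r (Suc N)" using strict_monoD[OF r, of N "Suc N"] by simp
  ultimately show False using far[of "r N" "r (Suc N)"] by simp
qed

text \<open>The infimum \<open>l\<close> of the Rayleigh quotient belongs to the spectrum: if \<open>T - l\<close> had an inverse
  bounded by \<open>C\<close>, take \<open>f\<close> nearly minimizing and \<open>g\<close> with \<open>T g - l * g = f\<close>. The non-negative
  form of \<open>T - l\<close> at \<open>f - t * g\<close> is at most \<open>e - 2 * t + t\<^sup>2 * C\<close>, which is negative for
  \<open>t = 1 / C\<close> once \<open>e < 1 / C\<close>.\<close>

lemma spectrum_nonempty: "l2_spectrum D T \<noteq> {}"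
proof -
  define A where "A = {Re (l2_inner (T f) f) | f. f \<in> D \<and> l2_norm f = 1}"
  define l where "l = Inf A"
  have bdd: "bdd_below A" unfolding A_def by (rule bdd_belowI[of _ 0]) (use nonneg in auto)
  have normalize: "\<exists>a. a > 0 \<and> l2_norm (\<lambda>x. complex_of_real a * f x) = 1"
    if "f \<in> D" "f \<noteq> (\<lambda>x. 0)" for f
  proof (intro exI conjI)
    have "0 < l2_norm f"
      using l2_norm_eq_0_iff[OF D_l2[OF that(1)]] that(2) l2_norm_nonneg[of f]
      by (metis less_eq_real_def)
    then show "0 < 1 / l2_norm f" "l2_norm (\<lambda>x. complex_of_real (1 / l2_norm f) * f x) = 1"
      unfolding l2_norm_cmult by (auto simp: norm_divide)
  qed
  obtain f where f: "f \<in> D" "(\<lambda>x. T f x + f x) = point_mass undefined"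
    using plus_identity_onto[OF point_mass_l2[of undefined]] by blast
  have "f \<noteq> (\<lambda>x. 0)"
  proof
    assume "f = (\<lambda>x. 0)"
    with fun_cong[OF f(2), of undefined] show False by (simp add: T_zero point_mass_def)
  qed
  with normalize[OF f(1)] D_cmult[OF f(1)] have Ane: "A \<noteq> {}" unfolding A_def by blast
  define s where "s f = Re (l2_inner (T f) f) - l * (l2_norm f)\<^sup>2" for f
  have s_nonneg: "0 \<le> s f" if fD: "f \<in> D" for f
  proof (cases "f = (\<lambda>x. 0)")
    case True
    then show ?thesis by (simp add: s_def T_zero l2_inner_def)
  next
    case False
    then obtain a where a: "a > 0" and n1: "l2_norm (\<lambda>x. complex_of_real a * f x) = 1"
      using normalize[OF fD] by blast
    have "Re (l2_inner (T (\<lambda>x. complex_of_real a * f x)) (\<lambda>x. complex_of_real a * f x)) \<in> A"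
      unfolding A_def using D_cmult[OF fD] n1 by blast
    from cInf_lower[OF this bdd]
    have "l \<le> a\<^sup>2 * Re (l2_inner (T f) f)"
      unfolding l_def[symmetric] T_cmult[OF fD] l2_inner_cmult_left l2_inner_cmult_right
      by (simp add: power2_eq_square)
    moreover have "a\<^sup>2 * (l2_norm f)\<^sup>2 = 1"
      using n1 a unfolding l2_norm_cmult by (simp flip: power_mult_distrib)
    ultimately have "a\<^sup>2 * (l * (l2_norm f)\<^sup>2) \<le> a\<^sup>2 * Re (l2_inner (T f) f)"
      by (metis (no_types, opaque_lifting) mult.left_commute mult.right_neutral)
    with a show ?thesis by (simp add: s_def)
  qed
  have "complex_of_real l \<in> l2_spectrum D T"
  proof (rule ccontr)
    assume "complex_of_real l \<notin> l2_spectrum D T"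
    then have bij: "bij_betw (\<lambda>f x. T f x - complex_of_real l * f x) D l2"
      and "\<exists>C. \<forall>f\<in>D. l2_norm f \<le> C * l2_norm (\<lambda>x. T f x - complex_of_real l * f x)"
      by (auto simp: l2_spectrum_def l2_resolvent_set_def)
    then obtain C0 where C0: "\<And>f. f \<in> D \<Longrightarrow>
        l2_norm f \<le> C0 * l2_norm (\<lambda>x. T f x - complex_of_real l * f x)" by blast
    define C where "C = max C0 1"
    have C: "C > 0" "C0 \<le> C" by (auto simp: C_def)
    obtain a where "a \<in> A" "a < l + 1 / C"
      using cInf_lessD[OF Ane, of "l + 1 / C"] C by (auto simp: l_def)
    then obtain f where fD: "f \<in> D" and f1: "l2_norm f = 1" and sf: "s f < 1 / C"
      unfolding A_def s_def by auto
    have "f \<in> (\<lambda>f x. T f x - complex_of_real l * f x) ` D"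
      using bij D_l2[OF fD] by (simp add: bij_betw_def)
    then obtain g where gD: "g \<in> D" and f_eq: "f = (\<lambda>x. T g x - complex_of_real l * g x)"
      by (rule imageE)
    note g = f_eq[symmetric]
    have gC: "l2_norm g \<le> C"
      using C0[OF gD] C unfolding g f1 by linarith
    have Tg: "T g = (\<lambda>x. f x + complex_of_real l * g x)" by (subst f_eq) simp
    note l2s = D_l2[OF fD] D_l2[OF gD] T_l2[OF fD] T_l2[OF gD]
    define fg where "fg = Re (l2_inner f g)"
    have gf: "Re (l2_inner g f) = fg" unfolding fg_def by (simp add: l2_inner_commute[of g f])
    have Tgf: "Re (l2_inner (T g) f) = 1 + l * fg"
      unfolding Tg using l2s
      by (simp add: l2_inner_add_left l2_cmult l2_inner_cmult_left l2_inner_self f1 gf)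
    have Tfg: "Re (l2_inner (T f) g) = 1 + l * fg"
      unfolding symmetric[OF fD gD] using Tgf by (simp add: l2_inner_commute[of f "T g"])
    have Tgg: "Re (l2_inner (T g) g) = fg + l * (l2_norm g)\<^sup>2"
      unfolding Tg using l2s
      by (simp add: l2_inner_add_left l2_cmult l2_inner_cmult_left l2_inner_self fg_def)
    have fgC: "fg \<le> C"
      using l2_cauchy_schwarz[OF l2s(1,2)] complex_Re_le_cmod[of "l2_inner f g"] gC f1
      unfolding fg_def by simp
    define t where "t = 1 / C"
    have t: "t > 0" using C by (simp add: t_def)
    define v where "v = (\<lambda>x. complex_of_real t * g x)"
    have vD: "v \<in> D" unfolding v_def by (intro D_cmult gD)
    have n: "(l2_norm (\<lambda>x. f x - v x))\<^sup>2 = 1 - 2 * t * fg + t\<^sup>2 * (l2_norm g)\<^sup>2"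
      using t unfolding l2_norm_diff_square[OF D_l2[OF fD] D_l2[OF vD]]
      unfolding v_def l2_inner_cmult_right l2_norm_cmult f1
      by (simp add: fg_def power_mult_distrib)
    have Tv: "T v = (\<lambda>x. complex_of_real t * T g x)" unfolding v_def by (rule T_cmult[OF gD])
    have "Re (l2_inner (T (\<lambda>x. f x - v x)) (\<lambda>x. f x - v x)) =
        Re (l2_inner (T f) f) - t * (1 + l * fg) - t * (1 + l * fg) + t\<^sup>2 * (fg + l * (l2_norm g)\<^sup>2)"
      unfolding T_diff[OF fD vD] Tv using l2s Tgf Tfg Tgg unfolding v_def
      by (simp add: l2_inner_diff_left l2_inner_diff_right l2_diff l2_cmult
          l2_inner_cmult_left l2_inner_cmult_right power2_eq_square algebra_simps)
    then have "s (\<lambda>x. f x - v x) = s f - 2 * t + t\<^sup>2 * fg"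
      unfolding s_def f1 n by (simp add: algebra_simps)
    also have "\<dots> < t - 2 * t + t\<^sup>2 * C"
      using sf mult_left_mono[OF fgC, of "t\<^sup>2"] by (simp add: t_def)
    also have "\<dots> = 0" using C by (simp add: t_def power2_eq_square)
    finally show False using s_nonneg[OF D_diff[OF fD vD]] by simp
  qed
  then show ?thesis by blast
qed

text \<open>A disc around a point of the spectrum only meets eigenvalues below a bound, hence finitely many.\<close>

theorem discrete_spectrum: "l2_spectrum D T = l2_discrete_spectrum D T"
proof (intro equalityI subsetI)
  fix z assume z: "z \<in> l2_spectrum D T"
  define L where "L = \<bar>Re z\<bar> + 1"
  have "finite {y \<in> l2_spectrum D T. Re y \<le> L}"
    by (rule finitely_many_eigenvalues) (simp add: L_def add_nonneg_pos)
  then have "finite (l2_spectrum D T \<inter> ball z 1)"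
  proof (rule finite_subset[rotated], intro subsetI)
    fix y assume "y \<in> l2_spectrum D T \<inter> ball z 1"
    then have "y \<in> l2_spectrum D T" "cmod (y - z) < 1" by (auto simp: dist_norm norm_minus_commute)
    with complex_Re_le_cmod[of "y - z"] show "y \<in> {y \<in> l2_spectrum D T. Re y \<le> L}"
      by (simp add: L_def)
  qed
  then have "\<not> z islimpt l2_spectrum D T"
    unfolding islimpt_eq_infinite_ball by (auto intro!: exI[of _ 1])
  with z have "z isolated_in l2_spectrum D T" by (simp add: isolated_in_islimpt_iff)
  with z show "z \<in> l2_discrete_spectrum D T"
    using eigenspace_finite_dim unfolding l2_discrete_spectrum_def spectrum_eq_eigenvalues by blast
next
  fix z assume "z \<in> l2_discrete_spectrum D T"
  then show "z \<in> l2_spectrum D T" by (simp add: l2_discrete_spectrum_def isolated_in_def)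
qed

lemma spectral_infimum_pos: "c \<le> Inf (Re ` l2_spectrum D T)"
  by (rule cInf_greatest)
     (use spectrum_nonempty eigenvalue_ge in \<open>auto simp: spectrum_eq_eigenvalues\<close>)

end

section \<open>The Laplacian as a selfadjoint operator\<close>

text \<open>The factor \<open>1 / sqrt 2\<close> accounts for every edge being counted in both directions; for a
  \<open>{0, 1}\<close>-valued \<open>b\<close> the energy form is then the inner product of gradients.\<close>

definition grad :: "('v \<Rightarrow> 'v \<Rightarrow> real) \<Rightarrow> ('v \<Rightarrow> complex) \<Rightarrow> 'v \<times> 'v \<Rightarrow> complex" where
  "grad b f = (\<lambda>(x, y). complex_of_real (b x y / sqrt 2) * (f x - f y))"

text \<open>The norm of \<open>with_grad b f\<close> is the form norm of \<open>f\<close>. In this picture the closed form becomes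
  a closed subspace of a Hilbert space, and solving \<open>laplacian b f + f = h\<close> becomes an orthogonal
  projection.\<close>

definition with_grad :: "('v \<Rightarrow> 'v \<Rightarrow> real) \<Rightarrow> ('v \<Rightarrow> complex) \<Rightarrow> 'v + 'v \<times> 'v \<Rightarrow> complex" where
  "with_grad b f = case_sum f (grad b f)"

lemma grad_add: "grad b (\<lambda>x. f x + g x) = (\<lambda>e. grad b f e + grad b g e)"
  by (simp add: grad_def fun_eq_iff split_beta add_diff_add distrib_left)

lemma grad_cmult: "grad b (\<lambda>x. a * f x) = (\<lambda>e. a * grad b f e)"
  by (auto simp: grad_def fun_eq_iff algebra_simps)

lemma grad_diff: "grad b (\<lambda>x. f x - g x) = (\<lambda>e. grad b f e - grad b g e)"
  using grad_add[of b f "\<lambda>x. -1 * g x"] grad_cmult[of b "-1" g] by simp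

lemma with_grad_add: "with_grad b (\<lambda>x. f x + g x) = (\<lambda>e. with_grad b f e + with_grad b g e)"
  by (auto simp: with_grad_def grad_add fun_eq_iff split: sum.split)

lemma with_grad_diff: "with_grad b (\<lambda>x. f x - g x) = (\<lambda>e. with_grad b f e - with_grad b g e)"
  by (auto simp: with_grad_def grad_diff fun_eq_iff split: sum.split)

lemma with_grad_cmult: "with_grad b (\<lambda>x. a * f x) = (\<lambda>e. a * with_grad b f e)"
  by (auto simp: with_grad_def grad_cmult fun_eq_iff split: sum.split)

lemma with_grad_l2_iff: "with_grad b f \<in> l2 \<longleftrightarrow> f \<in> l2 \<and> grad b f \<in> l2"
  unfolding l2_sum_type_iff by (simp add: with_grad_def)

lemma with_grad_norm:
  assumes "f \<in> l2" "grad b f \<in> l2"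
  shows "(l2_norm (with_grad b f))\<^sup>2 = (l2_norm f)\<^sup>2 + (l2_norm (grad b f))\<^sup>2"
  using l2_norm_sum_type[of "with_grad b f"] assms
  by (simp add: with_grad_l2_iff) (simp add: with_grad_def)

lemma l2_norm_le_with_grad:
  assumes "f \<in> l2" "grad b f \<in> l2"
  shows "l2_norm f \<le> l2_norm (with_grad b f)" "l2_norm (grad b f) \<le> l2_norm (with_grad b f)"
  by (rule power2_le_imp_le; simp add: with_grad_norm[OF assms])+

lemma grad_pointwise_limit:
  assumes "\<And>x. (\<lambda>n. f n x) \<longlonglongrightarrow> g x"
  shows "(\<lambda>n. grad b (f n) e) \<longlonglongrightarrow> grad b g e"
  unfolding grad_def split_def by (intro tendsto_intros assms)

locale unweighted_graph_locale =
  fixes b :: "'v \<Rightarrow> 'v \<Rightarrow> real"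
  assumes unweighted: "unweighted_graph b"
begin

lemma b_cases: "b x y = 0 \<or> b x y = 1"
  using unweighted by (auto simp: unweighted_graph_def)

lemma b_sym: "b x y = b y x"
  using unweighted by (auto simp: unweighted_graph_def)

lemma finite_neighbours: "finite {y. b x y = 1}"
  using unweighted by (auto simp: unweighted_graph_def)

lemma energy_form_eq_inner: "energy_form b f g = l2_inner (grad b f) (grad b g)"
proof -
  have "grad b f e * cnj (grad b g e) =
      1 / 2 * (case e of (x, y) \<Rightarrow> complex_of_real (b x y) * (f x - f y) * cnj (g x - g y))" for e
  proof (cases e)
    case (Pair x y)
    have "complex_of_real (sqrt 2) * complex_of_real (sqrt 2) = 2"
      by (simp flip: of_real_mult)
    then show ?thesis
      using b_cases[of x y] by (auto simp: Pair grad_def field_simps)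
  qed
  then show ?thesis
    unfolding energy_form_def l2_inner_def by (simp only: infsum_cmult_right')
qed

lemma energy_form_self:
  "grad b f \<in> l2 \<Longrightarrow> energy_form b f f = complex_of_real ((l2_norm (grad b f))\<^sup>2)"
  unfolding energy_form_eq_inner by (rule l2_inner_self)

lemma finitely_supported_l2: "\<phi> \<in> finitely_supported \<Longrightarrow> \<phi> \<in> l2"
  by (simp add: finitely_supported_def finite_support_l2)

lemma grad_finitely_supported_l2:
  assumes "\<phi> \<in> finitely_supported"
  shows "grad b \<phi> \<in> l2"
proof (rule finite_support_l2)
  define S where "S = {x. \<phi> x \<noteq> 0}"
  have S: "finite S" using assms by (simp add: S_def finitely_supported_def)
  let ?E = "(SIGMA x:S. {y. b x y = 1}) \<union> prod.swap ` (SIGMA x:S. {y. b x y = 1})"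
  have "finite ?E" using S finite_neighbours by auto
  moreover have "{e. grad b \<phi> e \<noteq> 0} \<subseteq> ?E"
  proof
    fix e assume "e \<in> {e. grad b \<phi> e \<noteq> 0}"
    moreover obtain x y where e: "e = (x, y)" by (cases e)
    ultimately have "b x y \<noteq> 0" "\<phi> x \<noteq> \<phi> y" by (auto simp: grad_def)
    then have "b x y = 1" "b y x = 1" "x \<in> S \<or> y \<in> S"
      using b_cases[of x y] b_sym[of y x] by (auto simp: S_def)
    then show "e \<in> ?E" unfolding e by (force simp: image_iff)
  qed
  ultimately show "finite {e. grad b \<phi> e \<noteq> 0}" by (rule finite_subset[rotated])
qed

lemma finitely_supported_diff:
  "\<phi> \<in> finitely_supported \<Longrightarrow> \<psi> \<in> finitely_supported \<Longrightarrow> (\<lambda>x. \<phi> x - \<psi> x) \<in> finitely_supported"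
  unfolding finitely_supported_def mem_Collect_eq
  by (rule finite_subset[of _ "{x. \<phi> x \<noteq> 0} \<union> {x. \<psi> x \<noteq> 0}"]) auto

lemma finitely_supported_add:
  "\<phi> \<in> finitely_supported \<Longrightarrow> \<psi> \<in> finitely_supported \<Longrightarrow> (\<lambda>x. \<phi> x + \<psi> x) \<in> finitely_supported"
  unfolding finitely_supported_def mem_Collect_eq
  by (rule finite_subset[of _ "{x. \<phi> x \<noteq> 0} \<union> {x. \<psi> x \<noteq> 0}"]) auto

lemma finitely_supported_cmult:
  "\<phi> \<in> finitely_supported \<Longrightarrow> (\<lambda>x. a * \<phi> x) \<in> finitely_supported"
  unfolding finitely_supported_def mem_Collect_eq
  by (rule finite_subset[of _ "{x. \<phi> x \<noteq> 0}"]) auto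

subsection \<open>The closure of the energy form\<close>

text \<open>The energy form is closable: the \<open>l2\<close>-limit of the gradients is also their pointwise limit and
  hence the gradient of the limit, so the limiting energies do not depend on the approximating
  sequence.\<close>

lemma form_approx_iff:
  "form_approx finitely_supported (energy_form b) \<phi> f \<longleftrightarrow>
     f \<in> l2 \<and> grad b f \<in> l2 \<and> (\<forall>n. \<phi> n \<in> finitely_supported) \<and>
     l2_tendsto \<phi> f \<and> l2_tendsto (\<lambda>n. grad b (\<phi> n)) (grad b f)"
  (is "?L \<longleftrightarrow> ?R")
proof -
  have norm: "cmod (energy_form b (\<lambda>x. \<phi> m x - \<phi> n x) (\<lambda>x. \<phi> m x - \<phi> n x)) =
      (l2_norm (\<lambda>e. grad b (\<phi> m) e - grad b (\<phi> n) e))\<^sup>2"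
    if "\<And>n. \<phi> n \<in> finitely_supported" for m n
    unfolding energy_form_self[OF grad_finitely_supported_l2[OF finitely_supported_diff[OF that that]]]
      grad_diff norm_of_real by simp
  show ?thesis
  proof
    assume L: ?L
    then have fs: "\<And>n. \<phi> n \<in> finitely_supported" and f: "f \<in> l2" and lim: "l2_tendsto \<phi> f"
      and C: "\<And>e. e > 0 \<Longrightarrow> \<exists>N. \<forall>m\<ge>N. \<forall>n\<ge>N.
        (l2_norm (\<lambda>e. grad b (\<phi> m) e - grad b (\<phi> n) e))\<^sup>2 < e"
      unfolding form_approx_def by (auto simp: norm)
    note gl2 = grad_finitely_supported_l2[OF fs]
    have "l2_Cauchy (\<lambda>n. grad b (\<phi> n))"
      unfolding l2_Cauchy_def
    proof (intro allI impI)
      fix e :: real assume e: "e > 0"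
      then obtain N where "\<And>m n. m \<ge> N \<Longrightarrow> n \<ge> N \<Longrightarrow>
          (l2_norm (\<lambda>x. grad b (\<phi> m) x - grad b (\<phi> n) x))\<^sup>2 < e\<^sup>2"
        using C[of "e\<^sup>2"] by auto
      then show "\<exists>N. \<forall>m\<ge>N. \<forall>n\<ge>N. l2_norm (\<lambda>x. grad b (\<phi> m) x - grad b (\<phi> n) x) < e"
        using e by (meson less_imp_le power2_less_imp_less)
    qed
    then obtain G where G: "G \<in> l2" "l2_tendsto (\<lambda>n. grad b (\<phi> n)) G"
      using l2_complete[of "\<lambda>n. grad b (\<phi> n)"] gl2 by blast
    have "(\<lambda>n. grad b (\<phi> n) e) \<longlonglongrightarrow> grad b f e" for e
      by (rule grad_pointwise_limit) (rule l2_tendsto_pointwise[OF finitely_supported_l2[OF fs] f lim])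
    moreover have "(\<lambda>n. grad b (\<phi> n) e) \<longlonglongrightarrow> G e" for e
      by (rule l2_tendsto_pointwise[OF gl2 G])
    ultimately have "G e = grad b f e" for e by (metis LIMSEQ_unique)
    then have "G = grad b f" by blast
    with f fs lim G show ?R by simp
  next
    assume R: ?R
    then have fs: "\<And>n. \<phi> n \<in> finitely_supported" by blast
    have "l2_Cauchy (\<lambda>n. grad b (\<phi> n))"
      by (rule l2_tendsto_imp_Cauchy[of _ "grad b f"]) (use R grad_finitely_supported_l2 in auto)
    have "\<exists>N. \<forall>m\<ge>N. \<forall>n\<ge>N. (l2_norm (\<lambda>x. grad b (\<phi> m) x - grad b (\<phi> n) x))\<^sup>2 < e"
      if e: "e > 0" for e
    proof -
      obtain N where N: "\<And>m n. m \<ge> N \<Longrightarrow> n \<ge> N \<Longrightarrow>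
          l2_norm (\<lambda>x. grad b (\<phi> m) x - grad b (\<phi> n) x) < sqrt e"
        using \<open>l2_Cauchy _\<close> e unfolding l2_Cauchy_def by (meson real_sqrt_gt_zero)
      have "(l2_norm (\<lambda>x. grad b (\<phi> m) x - grad b (\<phi> n) x))\<^sup>2 < e" if "m \<ge> N" "n \<ge> N" for m n
        using power_strict_mono[OF N[OF that], of 2] e by simp
      then show ?thesis by blast
    qed
    with R show ?L unfolding form_approx_def by (simp add: norm[OF fs])
  qed
qed

lemma dirichlet_dom_l2: "f \<in> dirichlet_dom b \<Longrightarrow> f \<in> l2 \<and> grad b f \<in> l2"
  by (auto simp: dirichlet_dom_def form_closure_dom_def form_approx_iff)

lemma dirichlet_domE:
  assumes "f \<in> dirichlet_dom b"
  obtains \<phi> where "\<And>n. \<phi> n \<in> finitely_supported" "l2_tendsto \<phi> f"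
    "l2_tendsto (\<lambda>n. grad b (\<phi> n)) (grad b f)"
  using assms by (auto simp: dirichlet_dom_def form_closure_dom_def form_approx_iff)

lemma dirichlet_form_eq:
  assumes "f \<in> dirichlet_dom b" "g \<in> dirichlet_dom b"
  shows "dirichlet_form b f g = l2_inner (grad b f) (grad b g)"
proof -
  have lim: "(\<lambda>n. energy_form b (\<phi> n) (\<psi> n)) \<longlonglongrightarrow> l2_inner (grad b f) (grad b g)"
    if "form_approx finitely_supported (energy_form b) \<phi> f"
      "form_approx finitely_supported (energy_form b) \<psi> g" for \<phi> \<psi>
    using that unfolding form_approx_iff energy_form_eq_inner
    by (intro l2_tendsto_inner) (auto intro: grad_finitely_supported_l2)
  obtain \<phi> \<psi> where approx: "form_approx finitely_supported (energy_form b) \<phi> f"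
    "form_approx finitely_supported (energy_form b) \<psi> g"
    using assms by (auto simp: dirichlet_dom_def form_closure_dom_def)
  show ?thesis
    unfolding dirichlet_form_def form_closure_def
  proof (rule the_equality)
    show "z = l2_inner (grad b f) (grad b g)"
      if "\<forall>\<phi> \<psi>. form_approx finitely_supported (energy_form b) \<phi> f \<longrightarrow>
        form_approx finitely_supported (energy_form b) \<psi> g \<longrightarrow>
        (\<lambda>n. energy_form b (\<phi> n) (\<psi> n)) \<longlonglongrightarrow> z" for z
      using that approx lim[OF approx] by (blast intro: LIMSEQ_unique)
  qed (use lim in blast)
qed

text \<open>The form domain is the closure of the finitely supported functions in the form norm; unlike
  sequences, the approximation within \<open>e\<close> lends itself to taking the closure twice.\<close>

lemma dirichlet_dom_iff:
  "f \<in> dirichlet_dom b \<longleftrightarrow> with_grad b f \<in> l2 \<and>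
     (\<forall>e>0. \<exists>\<phi>\<in>finitely_supported. l2_norm (\<lambda>x. with_grad b f x - with_grad b \<phi> x) < e)"
  (is "?L \<longleftrightarrow> ?R")
proof
  assume f: ?L
  then obtain \<phi> where fs: "\<And>n. \<phi> n \<in> finitely_supported" and lim: "l2_tendsto \<phi> f"
    and glim: "l2_tendsto (\<lambda>n. grad b (\<phi> n)) (grad b f)"
    using dirichlet_domE by blast
  have l2s: "f \<in> l2" "grad b f \<in> l2" using dirichlet_dom_l2[OF f] by auto
  have "(\<lambda>n. (l2_norm (\<lambda>x. \<phi> n x - f x))\<^sup>2 + (l2_norm (\<lambda>e. grad b (\<phi> n) e - grad b f e))\<^sup>2)
      \<longlonglongrightarrow> 0\<^sup>2 + 0\<^sup>2"
    by (intro tendsto_intros lim glim)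
  moreover have "(l2_norm (\<lambda>x. \<phi> n x - f x))\<^sup>2 + (l2_norm (\<lambda>e. grad b (\<phi> n) e - grad b f e))\<^sup>2 =
      (l2_norm (\<lambda>x. with_grad b f x - with_grad b (\<phi> n) x))\<^sup>2" for n
  proof -
    have "grad b (\<lambda>x. \<phi> n x - f x) \<in> l2"
      unfolding grad_diff by (intro l2_diff l2s grad_finitely_supported_l2 fs)
    from with_grad_norm[OF l2_diff[OF finitely_supported_l2[OF fs] l2s(1)] this]
    show ?thesis
      by (simp add: with_grad_diff grad_diff l2_norm_minus_commute[of "with_grad b f"])
  qed
  ultimately have "(\<lambda>n. (l2_norm (\<lambda>x. with_grad b f x - with_grad b (\<phi> n) x))\<^sup>2) \<longlonglongrightarrow> 0" by simp
  then have small: "\<exists>n. (l2_norm (\<lambda>x. with_grad b f x - with_grad b (\<phi> n) x))\<^sup>2 < d" if "d > 0" for d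
    using LIMSEQ_D[OF _ that] by fastforce
  have "\<exists>\<phi>\<in>finitely_supported. l2_norm (\<lambda>x. with_grad b f x - with_grad b \<phi> x) < e"
    if "e > 0" for e
    using small[of "e\<^sup>2"] that fs by (meson less_imp_le power2_less_imp_less zero_less_power)
  with l2s show ?R by (simp add: with_grad_l2_iff)
next
  assume R: ?R
  then have l2s: "f \<in> l2" "grad b f \<in> l2" by (auto simp: with_grad_l2_iff)
  have "\<forall>n. \<exists>\<phi>. \<phi> \<in> finitely_supported \<and>
      l2_norm (\<lambda>x. with_grad b f x - with_grad b \<phi> x) < 1 / real (Suc n)"
  proof
    fix n
    have "0 < 1 / real (Suc n)" by simp
    with R show "\<exists>\<phi>. \<phi> \<in> finitely_supported \<and>
        l2_norm (\<lambda>x. with_grad b f x - with_grad b \<phi> x) < 1 / real (Suc n)" by blast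
  qed
  from choice[OF this] obtain \<phi> where fs: "\<And>n. \<phi> n \<in> finitely_supported"
    and le: "\<And>n. l2_norm (\<lambda>x. with_grad b f x - with_grad b (\<phi> n) x) < 1 / real (Suc n)"
    by blast
  have "l2_norm (\<lambda>x. \<phi> n x - f x) \<le> 1 / real (Suc n)"
    "l2_norm (\<lambda>e. grad b (\<phi> n) e - grad b f e) \<le> 1 / real (Suc n)" for n
  proof -
    have *: "(\<lambda>x. \<phi> n x - f x) \<in> l2" "grad b (\<lambda>x. \<phi> n x - f x) \<in> l2"
      unfolding grad_diff
      by (intro l2_diff l2s grad_finitely_supported_l2 finitely_supported_l2 fs)+
    have "l2_norm (with_grad b (\<lambda>x. \<phi> n x - f x)) \<le> 1 / real (Suc n)"
      using le[of n] by (simp add: with_grad_diff l2_norm_minus_commute[of "with_grad b f"])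
    with l2_norm_le_with_grad[OF *]
    show "l2_norm (\<lambda>x. \<phi> n x - f x) \<le> 1 / real (Suc n)"
      "l2_norm (\<lambda>e. grad b (\<phi> n) e - grad b f e) \<le> 1 / real (Suc n)"
      by (simp_all add: grad_diff)
  qed
  then have "l2_tendsto \<phi> f" "l2_tendsto (\<lambda>n. grad b (\<phi> n)) (grad b f)"
    by (auto intro!: Lim_null_comparison[OF _ LIMSEQ_Suc[OF lim_1_over_n]] simp del: of_nat_Suc)
  with l2s fs have "form_approx finitely_supported (energy_form b) \<phi> f"
    unfolding form_approx_iff by simp
  then show ?L by (auto simp: dirichlet_dom_def form_closure_dom_def)
qed

lemma finitely_supported_dirichlet_dom: "\<phi> \<in> finitely_supported \<Longrightarrow> \<phi> \<in> dirichlet_dom b"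
  unfolding dirichlet_dom_iff
  by (auto simp: with_grad_l2_iff finitely_supported_l2 grad_finitely_supported_l2 intro: bexI[of _ \<phi>])

lemma dirichlet_dom_add:
  assumes f: "f \<in> dirichlet_dom b" and g: "g \<in> dirichlet_dom b"
  shows "(\<lambda>x. f x + g x) \<in> dirichlet_dom b"
  unfolding dirichlet_dom_iff
proof (intro conjI allI impI)
  have l2s: "with_grad b f \<in> l2" "with_grad b g \<in> l2" using f g by (auto simp: dirichlet_dom_iff)
  then show "with_grad b (\<lambda>x. f x + g x) \<in> l2" unfolding with_grad_add by (rule l2_add)
  fix e :: real assume "e > 0"
  then have e2: "e / 2 > 0" by simp
  obtain \<phi> where \<phi>: "\<phi> \<in> finitely_supported" "l2_norm (\<lambda>x. with_grad b f x - with_grad b \<phi> x) < e / 2"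
    using f e2 unfolding dirichlet_dom_iff by blast
  obtain \<psi> where \<psi>: "\<psi> \<in> finitely_supported" "l2_norm (\<lambda>x. with_grad b g x - with_grad b \<psi> x) < e / 2"
    using g e2 unfolding dirichlet_dom_iff by blast
  have l2s': "with_grad b \<phi> \<in> l2" "with_grad b \<psi> \<in> l2"
    using \<phi>(1) \<psi>(1) by (auto simp: with_grad_l2_iff finitely_supported_l2 grad_finitely_supported_l2)
  have split: "(\<lambda>x. with_grad b (\<lambda>x. f x + g x) x - with_grad b (\<lambda>x. \<phi> x + \<psi> x) x) =
      (\<lambda>x. (with_grad b f x - with_grad b \<phi> x) + (with_grad b g x - with_grad b \<psi> x))"
    unfolding with_grad_add by (simp add: algebra_simps)
  have "l2_norm (\<lambda>x. with_grad b (\<lambda>x. f x + g x) x - with_grad b (\<lambda>x. \<phi> x + \<psi> x) x) < e"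
    unfolding split
    using l2_norm_triangle[OF l2_diff[OF l2s(1) l2s'(1)] l2_diff[OF l2s(2) l2s'(2)]] \<phi>(2) \<psi>(2)
    by linarith
  then show "\<exists>\<phi>\<in>finitely_supported.
      l2_norm (\<lambda>x. with_grad b (\<lambda>x. f x + g x) x - with_grad b \<phi> x) < e"
    using finitely_supported_add[OF \<phi>(1) \<psi>(1)] by blast
qed

lemma dirichlet_dom_cmult:
  assumes f: "f \<in> dirichlet_dom b"
  shows "(\<lambda>x. a * f x) \<in> dirichlet_dom b"
  unfolding dirichlet_dom_iff
proof (intro conjI allI impI)
  have "with_grad b f \<in> l2" using f by (auto simp: dirichlet_dom_iff)
  then show "with_grad b (\<lambda>x. a * f x) \<in> l2" unfolding with_grad_cmult by (rule l2_cmult)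
  fix e :: real assume "e > 0"
  then have "e / (cmod a + 1) > 0" by (simp add: add_nonneg_pos)
  then obtain \<phi> where \<phi>: "\<phi> \<in> finitely_supported"
      "l2_norm (\<lambda>x. with_grad b f x - with_grad b \<phi> x) < e / (cmod a + 1)"
    using f unfolding dirichlet_dom_iff by blast
  have "l2_norm (\<lambda>x. with_grad b (\<lambda>x. a * f x) x - with_grad b (\<lambda>x. a * \<phi> x) x) =
      cmod a * l2_norm (\<lambda>x. with_grad b f x - with_grad b \<phi> x)"
    unfolding with_grad_cmult l2_norm_cmult[symmetric] by (simp add: algebra_simps)
  also have "\<dots> \<le> (cmod a + 1) * l2_norm (\<lambda>x. with_grad b f x - with_grad b \<phi> x)"
    by (intro mult_right_mono) auto
  also have "\<dots> < e" using \<phi>(2) by (simp add: pos_less_divide_eq add_nonneg_pos mult.commute)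
  finally show "\<exists>\<phi>\<in>finitely_supported.
      l2_norm (\<lambda>x. with_grad b (\<lambda>x. a * f x) x - with_grad b \<phi> x) < e"
    using finitely_supported_cmult[OF \<phi>(1)] by blast
qed

lemma dirichlet_dom_closed: "l2_closed_subspace (with_grad b ` dirichlet_dom b)"
  unfolding l2_closed_subspace_def
proof (intro conjI allI ballI impI)
  show "with_grad b ` dirichlet_dom b \<subseteq> l2" by (auto simp: dirichlet_dom_iff)
  have "(\<lambda>x. 0) \<in> dirichlet_dom b"
    by (rule finitely_supported_dirichlet_dom) (simp add: finitely_supported_def)
  moreover have "(\<lambda>_. 0) = with_grad b (\<lambda>x. 0)" using with_grad_cmult[of b 0 "\<lambda>x. 0"] by simp
  ultimately show "(\<lambda>_. 0) \<in> with_grad b ` dirichlet_dom b" by blast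
next
  fix u v assume "u \<in> with_grad b ` dirichlet_dom b" "v \<in> with_grad b ` dirichlet_dom b"
  then obtain f g where "f \<in> dirichlet_dom b" "g \<in> dirichlet_dom b"
    and uv: "u = with_grad b f" "v = with_grad b g" by blast
  from dirichlet_dom_add[OF this(1,2)] show "(\<lambda>x. u x + v x) \<in> with_grad b ` dirichlet_dom b"
    unfolding uv by (rule image_eqI[rotated]) (simp add: with_grad_add)
next
  fix a u assume "u \<in> with_grad b ` dirichlet_dom b"
  then obtain f where "f \<in> dirichlet_dom b" and u: "u = with_grad b f" by blast
  from dirichlet_dom_cmult[OF this(1)] show "(\<lambda>x. a * u x) \<in> with_grad b ` dirichlet_dom b"
    unfolding u by (rule image_eqI[rotated]) (simp add: with_grad_cmult)
next
  fix v h assume v: "\<forall>n::nat. v n \<in> with_grad b ` dirichlet_dom b" and h: "h \<in> l2"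
    and vh: "l2_tendsto v h"
  have "\<forall>n. \<exists>f. f \<in> dirichlet_dom b \<and> v n = with_grad b f" using v by blast
  from choice[OF this] obtain f where f: "\<And>n. f n \<in> dirichlet_dom b"
    and vf: "\<And>n. v n = with_grad b (f n)" by blast
  have vl2: "v n \<in> l2" for n using f[of n] by (simp add: vf dirichlet_dom_iff)
  note pointwise = l2_tendsto_pointwise[OF vl2 h vh]
  define g where "g x = h (Inl x)" for x
  have "(\<lambda>n. f n x) \<longlonglongrightarrow> g x" for x
    using pointwise[of "Inl x"] by (simp add: vf with_grad_def g_def)
  then have "(\<lambda>n. grad b (f n) e) \<longlonglongrightarrow> grad b g e" for e by (rule grad_pointwise_limit)
  moreover have "(\<lambda>n. grad b (f n) e) \<longlonglongrightarrow> h (Inr e)" for e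
    using pointwise[of "Inr e"] by (simp add: vf with_grad_def)
  ultimately have "grad b g e = h (Inr e)" for e by (rule LIMSEQ_unique)
  then have hg: "h = with_grad b g"
    by (auto simp: with_grad_def g_def fun_eq_iff split: sum.split)
  have "g \<in> dirichlet_dom b"
    unfolding dirichlet_dom_iff hg[symmetric]
  proof (intro conjI allI impI h)
    fix e :: real assume "e > 0"
    then have e2: "e / 2 > 0" by simp
    obtain n where n: "l2_norm (\<lambda>x. v n x - h x) < e / 2"
      using LIMSEQ_D[OF vh e2] by auto
    obtain \<phi> where \<phi>: "\<phi> \<in> finitely_supported" "l2_norm (\<lambda>x. v n x - with_grad b \<phi> x) < e / 2"
      using f[of n] e2 unfolding dirichlet_dom_iff vf by blast
    have "with_grad b \<phi> \<in> l2"
      using \<phi>(1) by (auto simp: with_grad_l2_iff finitely_supported_l2 grad_finitely_supported_l2)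
    from l2_dist_triangle[OF h vl2 this, of n]
    have "l2_norm (\<lambda>x. h x - with_grad b \<phi> x) < e"
      using n \<phi>(2) by (simp add: l2_norm_minus_commute[of h])
    with \<phi>(1) show "\<exists>\<phi>\<in>finitely_supported. l2_norm (\<lambda>x. h x - with_grad b \<phi> x) < e" by blast
  qed
  then show "h \<in> with_grad b ` dirichlet_dom b" unfolding hg by (rule imageI)
qed

subsection \<open>The operator of the closed form\<close>

lemma laplacianI:
  assumes f: "f \<in> dirichlet_dom b" and h: "h \<in> l2"
    and rep: "\<And>g. g \<in> dirichlet_dom b \<Longrightarrow> l2_inner (grad b f) (grad b g) = l2_inner h g"
  shows "f \<in> laplacian_dom b" "laplacian b f = h"
proof -
  have rep': "\<forall>g\<in>dirichlet_dom b. dirichlet_form b f g = l2_inner h g"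
    using rep by (simp add: dirichlet_form_eq f)
  with f h show "f \<in> laplacian_dom b" by (auto simp: laplacian_dom_def form_operator_dom_def)
  show "laplacian b f = h"
    unfolding laplacian_def form_operator_def
  proof (rule the_equality)
    fix k assume "k \<in> l2 \<and> (\<forall>g\<in>dirichlet_dom b. dirichlet_form b f g = l2_inner k g)"
    then have "l2_inner k g = l2_inner h g" if "g \<in> dirichlet_dom b" for g
      using rep' that by metis
    from this[OF finitely_supported_dirichlet_dom[OF point_mass_finitely_supported]]
    show "k = h" by (simp add: l2_inner_point_mass fun_eq_iff)
  qed (use h rep' in blast)
qed

lemma
  assumes "f \<in> laplacian_dom b"
  shows laplacian_dom_dirichlet: "f \<in> dirichlet_dom b"
    and laplacian_l2: "laplacian b f \<in> l2"
    and laplacian_represents: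
      "\<And>g. g \<in> dirichlet_dom b \<Longrightarrow> l2_inner (grad b f) (grad b g) = l2_inner (laplacian b f) g"
proof -
  obtain h where f: "f \<in> dirichlet_dom b" and h: "h \<in> l2"
    and rep: "\<And>g. g \<in> dirichlet_dom b \<Longrightarrow> l2_inner (grad b f) (grad b g) = l2_inner h g"
    using assms unfolding laplacian_dom_def form_operator_dom_def
    by (auto simp: dirichlet_form_eq)
  have "laplacian b f = h" using f h rep by (rule laplacianI(2))
  with f h rep show "f \<in> dirichlet_dom b" "laplacian b f \<in> l2"
    "\<And>g. g \<in> dirichlet_dom b \<Longrightarrow> l2_inner (grad b f) (grad b g) = l2_inner (laplacian b f) g"
    by simp_all
qed

lemma laplacian_quadratic_form:
  assumes "f \<in> laplacian_dom b"
  shows "Re (l2_inner (laplacian b f) f) = (l2_norm (grad b f))\<^sup>2"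
proof -
  have f: "f \<in> dirichlet_dom b" using assms by (rule laplacian_dom_dirichlet)
  then have "grad b f \<in> l2" using dirichlet_dom_l2 by blast
  then show ?thesis
    using arg_cong[OF laplacian_represents[OF assms f], of Re] by (simp add: l2_inner_self)
qed

text \<open>The point is surjectivity of \<open>laplacian b + 1\<close>. Projecting \<open>(h, 0)\<close> onto the closed
  subspace of all \<open>(f, grad b f)\<close> yields \<open>f\<close> for which \<open>(h - f, - grad b f)\<close> is orthogonal to all
  \<open>(g, grad b g)\<close>; this says that \<open>h - f\<close> represents the form at \<open>f\<close>.\<close>

lemma laplacian_nonneg_selfadjoint:
  "nonneg_selfadjoint_operator (laplacian_dom b) (laplacian b)"
proof
  fix f assume f: "f \<in> laplacian_dom b"
  note fd = laplacian_dom_dirichlet[OF f]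
  note l2s = conjunct1[OF dirichlet_dom_l2] conjunct2[OF dirichlet_dom_l2]
  show "f \<in> l2" using dirichlet_dom_l2[OF fd] by simp
  show "laplacian b f \<in> l2" using f by (rule laplacian_l2)
  show "0 \<le> Re (l2_inner (laplacian b f) f)" unfolding laplacian_quadratic_form[OF f] by simp
  have "l2_inner (grad b (\<lambda>x. a * f x)) (grad b g) = l2_inner (\<lambda>x. a * laplacian b f x) g"
    if "g \<in> dirichlet_dom b" for a g
    unfolding grad_cmult l2_inner_cmult_left laplacian_represents[OF f that] ..
  note cmult = laplacianI[OF dirichlet_dom_cmult[OF fd] l2_cmult[OF laplacian_l2[OF f]] this]
  show "(\<lambda>x. a * f x) \<in> laplacian_dom b" for a by (rule cmult(1))
  show "laplacian b (\<lambda>x. a * f x) = (\<lambda>x. a * laplacian b f x)" for a by (rule cmult(2))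
  fix g assume g: "g \<in> laplacian_dom b"
  note gd = laplacian_dom_dirichlet[OF g]
  have "l2_inner (grad b (\<lambda>x. f x + g x)) (grad b k) =
      l2_inner (\<lambda>x. laplacian b f x + laplacian b g x) k" if k: "k \<in> dirichlet_dom b" for k
    using laplacian_represents[OF f k] laplacian_represents[OF g k]
    by (simp add: grad_add l2_inner_add_left l2s fd gd k laplacian_l2 f g)
  note add = laplacianI[OF dirichlet_dom_add[OF fd gd]
      l2_add[OF laplacian_l2[OF f] laplacian_l2[OF g]] this]
  show "(\<lambda>x. f x + g x) \<in> laplacian_dom b" by (rule add(1))
  show "laplacian b (\<lambda>x. f x + g x) = (\<lambda>x. laplacian b f x + laplacian b g x)" by (rule add(2))
  have "l2_inner (laplacian b f) g = cnj (l2_inner (grad b g) (grad b f))"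
    unfolding laplacian_represents[OF f gd, symmetric] by (rule l2_inner_commute)
  also have "\<dots> = l2_inner f (laplacian b g)"
    unfolding laplacian_represents[OF g fd] by (rule l2_inner_commute[symmetric])
  finally show "l2_inner (laplacian b f) g = l2_inner f (laplacian b g)" .
next
  fix h :: "'v \<Rightarrow> complex" assume h: "h \<in> l2"
  note l2s = conjunct1[OF dirichlet_dom_l2] conjunct2[OF dirichlet_dom_l2]
  define H where "H = case_sum h (\<lambda>e :: 'v \<times> 'v. 0 :: complex)"
  have H: "H \<in> l2" unfolding l2_sum_type_iff by (simp add: H_def h)
  obtain p where p: "p \<in> with_grad b ` dirichlet_dom b"
    and orth: "\<And>m. m \<in> with_grad b ` dirichlet_dom b \<Longrightarrow> l2_inner (\<lambda>x. H x - p x) m = 0"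
    using l2_orthogonal_projection[OF dirichlet_dom_closed H] by blast
  from p obtain f where f: "f \<in> dirichlet_dom b" and pf: "p = with_grad b f" by blast
  have "l2_inner (grad b f) (grad b g) = l2_inner (\<lambda>x. h x - f x) g"
    if g: "g \<in> dirichlet_dom b" for g
  proof -
    have wg: "with_grad b g \<in> l2" "with_grad b f \<in> l2" using f g by (auto simp: dirichlet_dom_iff)
    have "l2_inner (\<lambda>x. h x - f x) g + l2_inner (\<lambda>e. 0 - grad b f e) (grad b g) = 0"
      using orth[OF imageI[OF g]] l2_inner_sum_type[OF l2_diff[OF H wg(2)] wg(1)]
      by (simp add: pf) (simp add: with_grad_def H_def)
    moreover have "l2_inner (\<lambda>e. 0 - grad b f e) (grad b g) = - l2_inner (grad b f) (grad b g)"
      using l2_inner_cmult_left[of "-1" "grad b f" "grad b g"] by simp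
    ultimately show ?thesis by simp
  qed
  from laplacianI[OF f l2_diff[OF h l2s(1)[OF f]] this]
  show "\<exists>f\<in>laplacian_dom b. (\<lambda>x. laplacian b f x + f x) = h"
    by (intro bexI[of _ f]) simp_all
qed

text \<open>An inequality between the energy and a potential extends from finitely supported functions to
  the form domain because it only involves finite partial sums on the side of the potential.\<close>

lemma laplacian_confined:
  assumes c: "0 < c" "\<And>x. c \<le> w x" and sublevel: "\<And>L. finite {x. w x \<le> L}"
    and hardy: "\<And>\<phi> F. \<phi> \<in> finitely_supported \<Longrightarrow> finite F \<Longrightarrow>
      (\<Sum>x\<in>F. w x * (cmod (\<phi> x))\<^sup>2) \<le> (l2_norm (grad b \<phi>))\<^sup>2"
  shows "confined_operator (laplacian_dom b) (laplacian b) w c"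
proof -
  interpret nonneg_selfadjoint_operator "laplacian_dom b" "laplacian b"
    by (rule laplacian_nonneg_selfadjoint)
  show ?thesis
  proof
    fix f and F :: "'v set" assume f: "f \<in> laplacian_dom b" and F: "finite F"
    have fd: "f \<in> dirichlet_dom b" using f by (rule laplacian_dom_dirichlet)
    then have l2s: "f \<in> l2" "grad b f \<in> l2" using dirichlet_dom_l2 by auto
    obtain \<phi> where \<phi>: "\<And>n. \<phi> n \<in> finitely_supported" "l2_tendsto \<phi> f"
      "l2_tendsto (\<lambda>n. grad b (\<phi> n)) (grad b f)"
      using dirichlet_domE[OF fd] by blast
    have "(\<Sum>x\<in>F. w x * (cmod (f x))\<^sup>2) \<le> (l2_norm (grad b f))\<^sup>2"
    proof (rule LIMSEQ_le)
      show "(\<lambda>n. \<Sum>x\<in>F. w x * (cmod (\<phi> n x))\<^sup>2) \<longlonglongrightarrow> (\<Sum>x\<in>F. w x * (cmod (f x))\<^sup>2)"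
        by (intro tendsto_intros l2_tendsto_pointwise[OF finitely_supported_l2[OF \<phi>(1)] l2s(1) \<phi>(2)])
      show "(\<lambda>n. (l2_norm (grad b (\<phi> n)))\<^sup>2) \<longlonglongrightarrow> (l2_norm (grad b f))\<^sup>2"
        by (intro tendsto_power l2_tendsto_norm grad_finitely_supported_l2 \<phi> l2s)
      show "\<exists>N. \<forall>n\<ge>N. (\<Sum>x\<in>F. w x * (cmod (\<phi> n x))\<^sup>2) \<le> (l2_norm (grad b (\<phi> n)))\<^sup>2"
        using hardy[OF \<phi>(1) F] by blast
    qed
    then show "(\<Sum>x\<in>F. w x * (cmod (f x))\<^sup>2) \<le> Re (l2_inner (laplacian b f) f)"
      unfolding laplacian_quadratic_form[OF f] .
  qed (use c sublevel in auto)
qed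

end

section \<open>Hardy inequalities from positive supersolutions\<close>

text \<open>Picone's inequality: the difference of the two sides is at least
  \<open>(q * cmod a - p * cmod c)\<^sup>2 / (p * q)\<close>.\<close>

lemma picone:
  fixes p q :: real and a c :: complex
  assumes "0 < p" "0 < q"
  shows "(p - q) * ((cmod a)\<^sup>2 / p - (cmod c)\<^sup>2 / q) \<le> (cmod (a - c))\<^sup>2"
proof -
  define A C where "A = cmod a" and "C = cmod c"
  have "0 \<le> (q * A - p * C)\<^sup>2 / (p * q)" using assms by simp
  also have "\<dots> = (A - C)\<^sup>2 - (p - q) * (A\<^sup>2 / p - C\<^sup>2 / q)"
    using assms by (simp add: field_simps power2_eq_square)
  finally have "(p - q) * (A\<^sup>2 / p - C\<^sup>2 / q) \<le> (A - C)\<^sup>2" by simp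
  also have "\<dots> \<le> (cmod (a - c))\<^sup>2"
    using norm_triangle_ineq3[of a c] by (metis A_def C_def abs_ge_zero power2_abs power_mono)
  finally show ?thesis by (simp add: A_def C_def)
qed

context unweighted_graph_locale
begin

text \<open>Sum Picone's inequality for \<open>a = \<phi> x\<close>, \<open>p = u x\<close> over all edges; summation by parts turns the
  left-hand side into the sum of the Laplacian of \<open>u\<close> against \<open>(cmod (\<phi> x))\<^sup>2 / u x\<close>.\<close>

theorem hardy_inequality:
  fixes u w :: "'v \<Rightarrow> real"
  assumes u: "\<And>x. 0 < u x" and w: "\<And>x. 0 \<le> w x"
    and supersolution: "\<And>x. w x * u x \<le> (\<Sum>y | b x y = 1. u x - u y)"
    and \<phi>: "\<phi> \<in> finitely_supported" and F: "finite F"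
  shows "(\<Sum>x\<in>F. w x * (cmod (\<phi> x))\<^sup>2) \<le> (l2_norm (grad b \<phi>))\<^sup>2"
proof -
  \<comment> \<open>Adding the neighbours of the support to \<open>B\<close> makes the sums over \<open>B\<close> see the full Laplacian of
    \<open>u\<close> at every point of the support.\<close>
  define S where "S = {x. \<phi> x \<noteq> 0}"
  have S: "finite S" using \<phi> by (simp add: S_def finitely_supported_def)
  define B where "B = S \<union> (\<Union>x\<in>S. {y. b x y = 1})"
  have B: "finite B" using S finite_neighbours by (simp add: B_def)
  define g where "g x = (cmod (\<phi> x))\<^sup>2 / u x" for x
  have g0: "g x = 0" if "x \<notin> S" for x using that by (simp add: g_def S_def)
  have g_nonneg: "0 \<le> g x" for x using u[of x] by (simp add: g_def)
  have local: "(\<Sum>y\<in>B. b x y * (u x - u y)) = (\<Sum>y | b x y = 1. u x - u y)" if "x \<in> S" for x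
  proof (rule sum.mono_neutral_cong_right)
    show "{y. b x y = 1} \<subseteq> B" using that by (auto simp: B_def)
  qed (use B b_cases in auto)
  have "(\<Sum>x\<in>F. w x * (cmod (\<phi> x))\<^sup>2) \<le> (\<Sum>x\<in>S. w x * (cmod (\<phi> x))\<^sup>2)"
  proof -
    have "(\<Sum>x\<in>F. w x * (cmod (\<phi> x))\<^sup>2) = (\<Sum>x\<in>F \<inter> S. w x * (cmod (\<phi> x))\<^sup>2)"
      using F by (intro sum.mono_neutral_right) (auto simp: S_def)
    also have "\<dots> \<le> (\<Sum>x\<in>S. w x * (cmod (\<phi> x))\<^sup>2)"
      using S w by (intro sum_mono2) auto
    finally show ?thesis .
  qed
  also have "\<dots> = (\<Sum>x\<in>S. g x * (w x * u x))"
  proof (rule sum.cong[OF refl])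
    fix x
    show "w x * (cmod (\<phi> x))\<^sup>2 = g x * (w x * u x)" using u[of x] by (simp add: g_def)
  qed
  also have "\<dots> \<le> (\<Sum>x\<in>S. g x * (\<Sum>y | b x y = 1. u x - u y))"
    by (intro sum_mono mult_left_mono supersolution g_nonneg)
  also have "\<dots> = (\<Sum>x\<in>S. g x * (\<Sum>y\<in>B. b x y * (u x - u y)))"
    by (simp add: local)
  also have "\<dots> = (\<Sum>x\<in>B. g x * (\<Sum>y\<in>B. b x y * (u x - u y)))"
    using B by (intro sum.mono_neutral_left) (auto simp: B_def g0)
  also have "\<dots> = (\<Sum>x\<in>B. \<Sum>y\<in>B. b x y * (u x - u y) * g x)"
    by (simp add: sum_distrib_left mult.commute)
  also have "\<dots> = (\<Sum>x\<in>B. \<Sum>y\<in>B. b x y / 2 * ((u x - u y) * (g x - g y)))"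
  proof -
    have "(\<Sum>x\<in>B. \<Sum>y\<in>B. b x y * (u x - u y) * g y) = (\<Sum>y\<in>B. \<Sum>x\<in>B. b x y * (u x - u y) * g y)"
      by (rule sum.swap)
    also have "\<dots> = - (\<Sum>x\<in>B. \<Sum>y\<in>B. b x y * (u x - u y) * g x)"
      unfolding sum_negf[symmetric]
      by (intro sum.cong refl) (subst b_sym, simp add: algebra_simps)
    finally have anti: "(\<Sum>x\<in>B. \<Sum>y\<in>B. b x y * (u x - u y) * g y) =
        - (\<Sum>x\<in>B. \<Sum>y\<in>B. b x y * (u x - u y) * g x)" .
    have "(\<Sum>x\<in>B. \<Sum>y\<in>B. b x y / 2 * ((u x - u y) * (g x - g y))) =
        (\<Sum>x\<in>B. \<Sum>y\<in>B. 1 / 2 * (b x y * (u x - u y) * g x) - 1 / 2 * (b x y * (u x - u y) * g y))"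
      by (intro sum.cong refl) (simp add: field_simps)
    also have "\<dots> = 1 / 2 * (\<Sum>x\<in>B. \<Sum>y\<in>B. b x y * (u x - u y) * g x) -
        1 / 2 * (\<Sum>x\<in>B. \<Sum>y\<in>B. b x y * (u x - u y) * g y)"
      by (simp only: sum_subtractf sum_distrib_left)
    finally show ?thesis unfolding anti by simp
  qed
  also have "\<dots> \<le> (\<Sum>x\<in>B. \<Sum>y\<in>B. (cmod (grad b \<phi> (x, y)))\<^sup>2)"
  proof (intro sum_mono)
    fix x y
    have "b x y / 2 * ((u x - u y) * (g x - g y)) \<le> b x y / 2 * (cmod (\<phi> x - \<phi> y))\<^sup>2"
      using picone[OF u u, of x y "\<phi> x" "\<phi> y"] b_cases[of x y]
      by (intro mult_left_mono) (auto simp: g_def)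
    also have "\<dots> = (cmod (grad b \<phi> (x, y)))\<^sup>2"
      using b_cases[of x y]
      by (auto simp: grad_def norm_mult norm_divide power_mult_distrib power_divide)
    finally show "b x y / 2 * ((u x - u y) * (g x - g y)) \<le> (cmod (grad b \<phi> (x, y)))\<^sup>2" .
  qed
  also have "\<dots> = (\<Sum>e\<in>B \<times> B. (cmod (grad b \<phi> e))\<^sup>2)"
    by (simp add: sum.cartesian_product)
  also have "\<dots> \<le> (l2_norm (grad b \<phi>))\<^sup>2"
    using B by (intro sum_square_le_l2_norm grad_finitely_supported_l2 \<phi>) auto
  finally show ?thesis .
qed

end

section \<open>Antitrees\<close>

locale antitree_locale =
  fixes b :: "'v \<Rightarrow> 'v \<Rightarrow> real" and x0 :: 'v
  assumes antitree: "antitree b x0"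
begin

sublocale unweighted_graph_locale b
  using antitree by unfold_locales (simp add: antitree_def)

abbreviation level :: "'v \<Rightarrow> nat" where
  "level x \<equiv> graph_dist b x x0"

abbreviation sphere_card :: "nat \<Rightarrow> nat" where
  "sphere_card r \<equiv> card (graph_sphere b x0 r)"

lemma path_of_length_level: "((\<lambda>u v. b u v = 1) ^^ level x) x x0"
proof -
  have "\<exists>n. ((\<lambda>u v. b u v = 1) ^^ n) x x0"
    using unweighted by (simp add: unweighted_graph_def rtranclp_power)
  then show ?thesis unfolding graph_dist_def by (rule LeastI_ex)
qed

lemma level_le: "((\<lambda>u v. b u v = 1) ^^ n) x x0 \<Longrightarrow> level x \<le> n"
  unfolding graph_dist_def by (rule Least_le)

lemma level_eq_0_iff: "level x = 0 \<longleftrightarrow> x = x0"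
  using path_of_length_level[of x] level_le[of 0 x] by auto

lemma level_neighbour: "b x y = 1 \<Longrightarrow> level x \<le> Suc (level y)"
  by (rule level_le, rule relpowp_Suc_I2[where y = y]) (simp_all add: path_of_length_level)

lemma neighbour_below:
  assumes "level x = Suc n"
  obtains y where "b x y = 1" "level y = n"
proof -
  have "((\<lambda>u v. b u v = 1) ^^ Suc n) x x0"
    using path_of_length_level[of x] unfolding assms .
  then obtain y where y: "b x y = 1" "((\<lambda>u v. b u v = 1) ^^ n) y x0"
    by (rule relpowp_Suc_E2)
  with level_le[OF y(2)] level_neighbour[OF y(1)] assms that show ?thesis by simp
qed

lemma finite_sphere: "finite (graph_sphere b x0 r)"
proof (induction r)
  case 0
  show ?case by (simp add: graph_sphere_def level_eq_0_iff)
next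
  case (Suc r)
  have "graph_sphere b x0 (Suc r) \<subseteq> (\<Union>y\<in>graph_sphere b x0 r. {x. b y x = 1})"
  proof
    fix x assume "x \<in> graph_sphere b x0 (Suc r)"
    then have "level x = Suc r" by (simp add: graph_sphere_def)
    then obtain y where "b x y = 1" "level y = r" by (rule neighbour_below)
    then show "x \<in> (\<Union>y\<in>graph_sphere b x0 r. {x. b y x = 1})"
      using b_sym[of x y] by (auto simp: graph_sphere_def)
  qed
  then show ?case using Suc finite_neighbours by (auto intro: finite_subset)
qed

text \<open>An empty sphere would make all later ones empty and the graph finite.\<close>

lemma sphere_nonempty: "graph_sphere b x0 r \<noteq> {}"
proof
  assume empty: "graph_sphere b x0 r = {}"
  have "graph_sphere b x0 (r + k) = {}" for k
  proof (induction k)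
    case (Suc k)
    show ?case
    proof (rule equals0I)
      fix x assume "x \<in> graph_sphere b x0 (r + Suc k)"
      then have "level x = Suc (r + k)" by (simp add: graph_sphere_def)
      then obtain y where "level y = r + k" by (rule neighbour_below)
      then have "y \<in> graph_sphere b x0 (r + k)" by (simp add: graph_sphere_def)
      with Suc show False by simp
    qed
  qed (simp add: empty)
  note later = this
  have "level x < r" for x
  proof (rule ccontr)
    assume "\<not> level x < r"
    then have "x \<in> graph_sphere b x0 (r + (level x - r))" by (simp add: graph_sphere_def)
    then show False by (simp only: later empty_iff)
  qed
  then have "(UNIV :: 'v set) \<subseteq> (\<Union>i<r. graph_sphere b x0 i)"
    by (auto simp: graph_sphere_def)
  then have "finite (UNIV :: 'v set)" using finite_sphere by (auto intro: finite_subset)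
  then show False using unweighted by (simp add: unweighted_graph_def)
qed

lemma sphere_card_pos: "0 < sphere_card r"
  using finite_sphere sphere_nonempty by (simp add: card_gt_0_iff)

lemma kappa_plus_eq_radial:
  assumes "level x = r"
  shows "kappa_plus b x0 x = kappa_plus_radial b x0 r"
proof -
  have "weakly_spherically_symmetric b x0" using antitree by (simp add: antitree_def)
  then have same: "\<forall>y\<in>graph_sphere b x0 r. kappa_plus b x0 y = kappa_plus b x0 x"
    unfolding weakly_spherically_symmetric_def graph_sphere_def assms[symmetric] by blast
  show ?thesis
    unfolding kappa_plus_radial_def
  proof (rule the_equality[symmetric])
    show "\<forall>y\<in>graph_sphere b x0 r. kappa_plus b x0 y = kappa_plus b x0 x" by (rule same)
    fix k assume "\<forall>y\<in>graph_sphere b x0 r. kappa_plus b x0 y = k"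
    moreover have "x \<in> graph_sphere b x0 r" by (simp add: graph_sphere_def assms)
    ultimately have "kappa_plus b x0 x = k" by (rule bspec)
    then show "k = kappa_plus b x0 x" ..
  qed
qed

lemma kappa_plus_radial_eq: "kappa_plus_radial b x0 r = sphere_card (Suc r)"
  using antitree by (simp add: antitree_def)

text \<open>A vertex has as many neighbours in the next sphere as that sphere has elements.\<close>

lemma consecutive_spheres_joined:
  assumes "level y = Suc (level x)"
  shows "b x y = 1"
proof -
  have "{y. b x y = 1 \<and> level y = Suc (level x)} = graph_sphere b x0 (Suc (level x))"
  proof (rule card_subset_eq[OF finite_sphere])
    show "card {y. b x y = 1 \<and> level y = Suc (level x)} = sphere_card (Suc (level x))"
      using kappa_plus_eq_radial[OF refl, of x] unfolding kappa_plus_def kappa_plus_radial_eq .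
  qed (auto simp: graph_sphere_def)
  moreover have "y \<in> graph_sphere b x0 (Suc (level x))" using assms by (simp add: graph_sphere_def)
  ultimately show ?thesis by blast
qed

text \<open>The Laplacian of a radial function; edges within a sphere do not contribute.\<close>

lemma sum_neighbours_radial:
  fixes U :: "nat \<Rightarrow> real"
  shows "(\<Sum>y | b x y = 1. U (level x) - U (level y)) =
    sphere_card (Suc (level x)) * (U (level x) - U (Suc (level x))) +
    (case level x of 0 \<Rightarrow> 0 | Suc k \<Rightarrow> sphere_card k * (U (Suc k) - U k))"
proof -
  define r where "r = level x"
  define N where "N = {y. b x y = 1 \<and> level y = r}"
  define P where "P = {y. Suc (level y) = r}"
  have split: "{y. b x y = 1} = graph_sphere b x0 (Suc r) \<union> P \<union> N"
  proof (intro equalityI subsetI)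
    fix y assume "y \<in> {y. b x y = 1}"
    then have y: "b x y = 1" "b y x = 1" using b_sym[of x y] by auto
    from level_neighbour[OF y(1)] level_neighbour[OF y(2)]
    have "level y = Suc r \<or> Suc (level y) = r \<or> level y = r" unfolding r_def by linarith
    with y show "y \<in> graph_sphere b x0 (Suc r) \<union> P \<union> N"
      by (auto simp: graph_sphere_def P_def N_def)
  next
    fix y assume "y \<in> graph_sphere b x0 (Suc r) \<union> P \<union> N"
    then show "y \<in> {y. b x y = 1}"
      using consecutive_spheres_joined[of y x] consecutive_spheres_joined[of x y] b_sym[of x y]
      by (auto simp: graph_sphere_def P_def N_def r_def)
  qed
  have fin: "finite P" "finite N"
    using finite_neighbours[of x] unfolding split by auto
  have disjoint: "graph_sphere b x0 (Suc r) \<inter> P = {}" "(graph_sphere b x0 (Suc r) \<union> P) \<inter> N = {}"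
    by (auto simp: graph_sphere_def P_def N_def)
  have "(\<Sum>y | b x y = 1. U r - U (level y)) =
      (\<Sum>y\<in>graph_sphere b x0 (Suc r). U r - U (level y)) + (\<Sum>y\<in>P. U r - U (level y)) +
      (\<Sum>y\<in>N. U r - U (level y))"
    unfolding split sum.union_disjoint[OF finite_UnI[OF finite_sphere fin(1)] fin(2) disjoint(2)]
      sum.union_disjoint[OF finite_sphere fin(1) disjoint(1)] ..
  also have "(\<Sum>y\<in>N. U r - U (level y)) = 0" by (rule sum.neutral) (simp add: N_def)
  also have "(\<Sum>y\<in>graph_sphere b x0 (Suc r). U r - U (level y)) =
      sphere_card (Suc r) * (U r - U (Suc r))"
    by (simp add: graph_sphere_def)
  also have "(\<Sum>y\<in>P. U r - U (level y)) =
      (case r of 0 \<Rightarrow> 0 | Suc k \<Rightarrow> sphere_card k * (U (Suc k) - U k))"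
    by (cases r) (simp_all add: P_def graph_sphere_def)
  finally show ?thesis by (simp add: r_def)
qed

lemma graph_volume_eq_sum: "graph_volume b x0 r = (\<Sum>i\<le>r. sphere_card i)"
  unfolding graph_volume_def graph_ball_def
  by (rule card_UN_disjoint) (simp_all add: finite_sphere, auto simp: graph_sphere_def)

lemma graph_volume_0: "graph_volume b x0 0 = sphere_card 0"
  by (simp add: graph_volume_eq_sum)

lemma graph_volume_Suc: "graph_volume b x0 (Suc r) = graph_volume b x0 r + sphere_card (Suc r)"
  by (simp add: graph_volume_eq_sum)

lemma graph_volume_pos: "0 < graph_volume b x0 r"
  using sphere_card_pos[of 0] by (induction r) (simp_all add: graph_volume_0 graph_volume_Suc)

text \<open>The flux of the gradient of the torsion function below through the edges between the spheres
  of radius \<open>k\<close> and \<open>Suc k\<close> is \<open>graph_volume b x0 k\<close>, by Gauss' theorem; hence its decrease is the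
  following quotient.\<close>

definition torsion_decrement :: "nat \<Rightarrow> real" where
  "torsion_decrement k =
     graph_volume b x0 k / (real (sphere_card k) * real (sphere_card (Suc k)))"

text \<open>In the theory of elasticity and of Brownian motion, the positive function with Laplacian \<open>1\<close>
  that vanishes at the boundary (here, at infinity) is called torsion function or expected lifetime.\<close>

definition torsion :: "nat \<Rightarrow> real" where
  "torsion r = (\<Sum>k. torsion_decrement (k + r))"

lemma torsion_decrement_pos: "0 < torsion_decrement k"
  by (simp add: torsion_decrement_def graph_volume_pos sphere_card_pos)

context
  assumes summable_torsion: "summable torsion_decrement"
begin

lemma torsion_diff: "torsion r - torsion (Suc r) = torsion_decrement r"
  using suminf_split_head[OF summable_ignore_initial_segment[OF summable_torsion, of r]]
  by (simp add: torsion_def)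

lemma torsion_pos: "0 < torsion r"
  unfolding torsion_def
  by (rule suminf_pos[OF summable_ignore_initial_segment[OF summable_torsion]])
     (rule torsion_decrement_pos)

lemma torsion_le: "torsion r \<le> torsion 0"
proof -
  have "torsion (Suc k) \<le> torsion k" for k
    using torsion_diff[of k] torsion_decrement_pos[of k] by linarith
  then have "decseq torsion" by (rule decseq_SucI)
  then show ?thesis by (rule decseqD) simp
qed

lemma torsion_tendsto_0: "torsion \<longlonglongrightarrow> 0"
  unfolding torsion_def[abs_def] by (rule suminf_exist_split2[OF summable_torsion])

text \<open>The fluxes through the two sides of a sphere are the volumes of the corresponding balls, which
  differ by the number of vertices of the sphere.\<close>

lemma torsion_laplacian: "(\<Sum>y | b x y = 1. torsion (level x) - torsion (level y)) = 1"
proof -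
  have up: "sphere_card (Suc r) * (torsion r - torsion (Suc r)) =
      graph_volume b x0 r / sphere_card r" for r
    using sphere_card_pos[of "Suc r"] by (simp add: torsion_diff torsion_decrement_def)
  have down: "sphere_card k * (torsion (Suc k) - torsion k) =
      - (graph_volume b x0 k / sphere_card (Suc k))" for k
  proof -
    have "torsion (Suc k) - torsion k = - torsion_decrement k"
      using torsion_diff[of k] by simp
    then show ?thesis
      using sphere_card_pos[of k] by (simp add: torsion_decrement_def)
  qed
  show ?thesis
  proof (cases "level x")
    case 0
    then show ?thesis
      using sum_neighbours_radial[of torsion x] up[of 0] sphere_card_pos[of 0]
      by (simp add: graph_volume_0)
  next
    case (Suc k)
    have "real (graph_volume b x0 (Suc k)) / sphere_card (Suc k) =
        graph_volume b x0 k / sphere_card (Suc k) + 1"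
      using sphere_card_pos[of "Suc k"] by (simp add: graph_volume_Suc add_divide_distrib)
    then show ?thesis
      using sum_neighbours_radial[of torsion x] by (simp add: Suc up down)
  qed
qed

text \<open>The torsion function has Laplacian \<open>1 = (1 / torsion) * torsion\<close>, so it is the supersolution that
  \<open>hardy_inequality\<close> asks for with the weight \<open>1 / torsion\<close>. Sublevel sets of this weight are finite
  because the torsion function tends to zero.\<close>

theorem laplacian_confined_by_torsion:
  "confined_operator (laplacian_dom b) (laplacian b) (\<lambda>x. 1 / torsion (level x)) (1 / torsion 0)"
proof (rule laplacian_confined)
  show "0 < 1 / torsion 0" using torsion_pos by simp
  show "1 / torsion 0 \<le> 1 / torsion (level x)" for x
    using torsion_pos torsion_le by (intro divide_left_mono mult_pos_pos) auto
  show "finite {x. 1 / torsion (level x) \<le> L}" for L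
  proof -
    have "0 < 1 / (\<bar>L\<bar> + 1)" by (simp add: add_nonneg_pos)
    then obtain N where N: "\<And>r. r \<ge> N \<Longrightarrow> \<bar>torsion r\<bar> < 1 / (\<bar>L\<bar> + 1)"
      using LIMSEQ_D[OF torsion_tendsto_0] by fastforce
    have "level x < N" if "1 / torsion (level x) \<le> L" for x
    proof (rule ccontr)
      assume "\<not> level x < N"
      then have "torsion (level x) < 1 / (\<bar>L\<bar> + 1)" using N[of "level x"] by simp
      then have "\<bar>L\<bar> + 1 < 1 / torsion (level x)"
        using torsion_pos[of "level x"] by (simp add: field_simps)
      with that show False by linarith
    qed
    then have "{x. 1 / torsion (level x) \<le> L} \<subseteq> (\<Union>i<N. graph_sphere b x0 i)"
      by (auto simp: graph_sphere_def)
    then show ?thesis using finite_sphere by (auto intro: finite_subset)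
  qed
  show "(\<Sum>x\<in>F. 1 / torsion (level x) * (cmod (\<phi> x))\<^sup>2) \<le> (l2_norm (grad b \<phi>))\<^sup>2"
    if "\<phi> \<in> finitely_supported" "finite F" for \<phi> F
  proof (rule hardy_inequality[where u = "\<lambda>x. torsion (level x)", OF _ _ _ that])
    fix x
    show "0 < torsion (level x)" by (rule torsion_pos)
    then show "0 \<le> 1 / torsion (level x)"
      "1 / torsion (level x) * torsion (level x) \<le>
        (\<Sum>y | b x y = 1. torsion (level x) - torsion (level y))"
      unfolding torsion_laplacian by simp_all
  qed
qed

end

subsection \<open>Polynomially growing spheres\<close>

context
  fixes \<beta> c C :: real
  assumes \<beta>: "0 < \<beta>" and c: "0 < c"
    and sphere_lower: "\<And>r. r \<ge> 1 \<Longrightarrow> c * real r powr \<beta> \<le> sphere_card (Suc r)"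
    and sphere_upper: "\<And>r. r \<ge> 1 \<Longrightarrow> sphere_card (Suc r) \<le> C * real r powr \<beta>"
begin

text \<open>Induction on \<open>r\<close>: with \<open>M\<close> for the constant,
  \<open>M * r powr (\<beta> + 1) + C * r powr \<beta> \<le> M * (r + 1) * r powr \<beta>\<close>.\<close>

lemma volume_upper:
  "r \<ge> 1 \<Longrightarrow> graph_volume b x0 r \<le> max (graph_volume b x0 1) C * real r powr (\<beta> + 1)"
proof (induction r rule: nat_induct_at_least)
  case (Suc r)
  define M where "M = max (real (graph_volume b x0 1)) C"
  have M: "0 \<le> M" "C \<le> M" by (auto simp: M_def le_max_iff_disj)
  have "real (graph_volume b x0 (Suc r)) \<le> M * real r powr (\<beta> + 1) + C * real r powr \<beta>"
    unfolding graph_volume_Suc using Suc.IH sphere_upper[OF Suc.hyps] by (simp add: M_def)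
  also have "\<dots> \<le> M * real r powr (\<beta> + 1) + M * real r powr \<beta>"
    using M by (intro add_left_mono mult_right_mono) auto
  also have "\<dots> = M * (real r powr \<beta> * real (Suc r))"
    using Suc.hyps by (simp add: powr_add algebra_simps)
  also have "\<dots> \<le> M * (real (Suc r) powr \<beta> * real (Suc r))"
    using M \<beta> by (intro mult_left_mono mult_right_mono powr_mono2) auto
  also have "\<dots> = M * real (Suc r) powr (\<beta> + 1)" by (simp add: powr_add)
  finally show ?case by (simp add: M_def)
qed simp

text \<open>By the mean value theorem, the increments of \<open>r powr (\<beta> + 1)\<close> are at most
  \<open>(\<beta> + 1) * (r + 1) powr \<beta>\<close>, and \<open>r + 1 \<le> 2 * r\<close>.\<close>

lemma volume_lower:
  "r \<ge> 1 \<Longrightarrow>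
    min (graph_volume b x0 1) (c / ((\<beta> + 1) * 2 powr \<beta>)) * real r powr (\<beta> + 1)
      \<le> graph_volume b x0 r"
proof (induction r rule: nat_induct_at_least)
  case (Suc r)
  define m where "m = min (real (graph_volume b x0 1)) (c / ((\<beta> + 1) * 2 powr \<beta>))"
  have m: "0 \<le> m" "m * ((\<beta> + 1) * 2 powr \<beta>) \<le> c"
  proof -
    show "0 \<le> m" using c \<beta> by (simp add: m_def)
    have "m \<le> c / ((\<beta> + 1) * 2 powr \<beta>)" by (simp add: m_def)
    then show "m * ((\<beta> + 1) * 2 powr \<beta>) \<le> c" using \<beta> by (simp add: pos_le_divide_eq)
  qed
  have r: "0 < real r" using Suc.hyps by simp
  have "\<exists>z. real r < z \<and> z < real (Suc r) \<and>
      real (Suc r) powr (\<beta> + 1) - real r powr (\<beta> + 1) =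
      (real (Suc r) - real r) * ((\<beta> + 1) * z powr (\<beta> + 1 - 1))"
    using r by (intro MVT2 has_real_derivative_powr) auto
  then obtain z where z: "real r < z" "z < real (Suc r)"
    and incr: "real (Suc r) powr (\<beta> + 1) - real r powr (\<beta> + 1) = (\<beta> + 1) * z powr \<beta>"
    by auto
  have "z powr \<beta> \<le> (2 * real r) powr \<beta>"
    using z r \<beta> Suc.hyps by (intro powr_mono2) auto
  also have "\<dots> = 2 powr \<beta> * real r powr \<beta>" using r by (simp add: powr_mult)
  finally have "m * (real (Suc r) powr (\<beta> + 1) - real r powr (\<beta> + 1)) \<le>
      m * ((\<beta> + 1) * (2 powr \<beta> * real r powr \<beta>))"
    unfolding incr using m \<beta> by (intro mult_left_mono) auto
  also have "\<dots> = (m * ((\<beta> + 1) * 2 powr \<beta>)) * real r powr \<beta>" by (simp add: mult_ac)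
  also have "\<dots> \<le> c * real r powr \<beta>" using m by (intro mult_right_mono) auto
  also have "\<dots> \<le> sphere_card (Suc r)" by (rule sphere_lower[OF Suc.hyps])
  finally show ?case
    using Suc.IH unfolding graph_volume_Suc m_def[symmetric] by (simp add: algebra_simps)
qed simp

lemma volume_comparable:
  "comparable (\<lambda>r. real (graph_volume b x0 r)) (\<lambda>r. real r powr (\<beta> + 1))"
  unfolding comparable_def
proof (intro exI conjI allI impI)
  fix r :: nat assume "1 \<le> r"
  then show "min (real (graph_volume b x0 1)) (c / ((\<beta> + 1) * 2 powr \<beta>)) * real r powr (\<beta> + 1) \<le>
      real (graph_volume b x0 r)"
    "real (graph_volume b x0 r) \<le>
      max (real (graph_volume b x0 1)) C * real r powr (\<beta> + 1)"
    by (rule volume_lower, rule volume_upper)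
next
  show "0 < min (real (graph_volume b x0 1)) (c / ((\<beta> + 1) * 2 powr \<beta>))"
    using graph_volume_pos[of 1] c \<beta> by simp
  show "0 < max (real (graph_volume b x0 1)) C"
    using graph_volume_pos[of 1] by (simp add: less_max_iff_disj)
qed

text \<open>The general term is at most a multiple of \<open>k powr (1 - \<beta>)\<close>; the shift in \<open>sphere_lower\<close> costs
  a factor \<open>2 powr \<beta>\<close> because \<open>k / 2 \<le> k - 1\<close> for \<open>k \<ge> 2\<close>.\<close>

lemma torsion_decrement_summable:
  assumes "2 < \<beta>"
  shows "summable torsion_decrement"
proof (rule summable_comparison_test')
  define M where "M = max (real (graph_volume b x0 1)) C"
  have M: "0 \<le> M" by (simp add: M_def le_max_iff_disj)
  show "summable (\<lambda>k. M * 2 powr \<beta> / c\<^sup>2 * real k powr (1 - \<beta>))"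
    using assms by (intro summable_mult) (simp add: summable_real_powr_iff)
  fix k :: nat assume k: "k \<ge> 2"
  then have kpos: "0 < real k" by simp
  have s1: "c * (real k powr \<beta> / 2 powr \<beta>) \<le> sphere_card k"
  proof -
    have "real k powr \<beta> / 2 powr \<beta> = (real k / 2) powr \<beta>" using k by (simp add: powr_divide)
    also have "\<dots> \<le> real (k - 1) powr \<beta>" using k \<beta> by (intro powr_mono2) auto
    finally have "c * (real k powr \<beta> / 2 powr \<beta>) \<le> c * real (k - 1) powr \<beta>"
      using c by (simp only: mult_le_cancel_left_pos)
    also have "\<dots> \<le> sphere_card (Suc (k - 1))" using k by (intro sphere_lower) simp
    finally show ?thesis using k by simp
  qed
  have s2: "c * real k powr \<beta> \<le> sphere_card (Suc k)" using k by (intro sphere_lower) simp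
  have V: "graph_volume b x0 k \<le> M * real k powr (\<beta> + 1)"
    unfolding M_def using k by (intro volume_upper) simp
  have "norm (torsion_decrement k) = torsion_decrement k"
    using torsion_decrement_pos[of k] by simp
  also have "\<dots> \<le> M * real k powr (\<beta> + 1) /
      ((c * (real k powr \<beta> / 2 powr \<beta>)) * (c * real k powr \<beta>))"
    unfolding torsion_decrement_def using V s1 s2 c kpos M
    by (intro frac_le mult_mono mult_pos_pos divide_pos_pos) auto
  also have "\<dots> = M * 2 powr \<beta> / c\<^sup>2 * (real k powr (\<beta> + 1) / (real k powr \<beta> * real k powr \<beta>))"
    by (simp add: power2_eq_square mult_ac)
  also have "real k powr (\<beta> + 1) / (real k powr \<beta> * real k powr \<beta>) = real k powr (1 - \<beta>)"
    unfolding powr_add[symmetric] powr_diff[symmetric] by simp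
  finally show "norm (torsion_decrement k) \<le> M * 2 powr \<beta> / c\<^sup>2 * real k powr (1 - \<beta>)" .
qed

end

end

theorem corollary6p6:
  fixes b :: "'v \<Rightarrow> 'v \<Rightarrow> real" and x0 :: 'v and \<beta> :: real
  assumes "\<beta> > 2"
    and "antitree b x0"
    and "comparable (\<lambda>r. real (kappa_plus_radial b x0 r)) (\<lambda>r. real r powr \<beta>)"
  shows "comparable (\<lambda>r. real (graph_volume b x0 r)) (\<lambda>r. real r powr (\<beta> + 1)) \<and>
         spectral_bottom b > 0 \<and>
         laplacian_spectrum b = laplacian_discrete_spectrum b"
proof -
  interpret antitree_locale b x0 using assms(2) by unfold_locales
  obtain c C where c: "0 < c"
    and lower: "\<And>r. r \<ge> 1 \<Longrightarrow> c * real r powr \<beta> \<le> sphere_card (Suc r)"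
    and upper: "\<And>r. r \<ge> 1 \<Longrightarrow> sphere_card (Suc r) \<le> C * real r powr \<beta>"
    using assms(3) unfolding comparable_def kappa_plus_radial_eq by auto
  have \<beta>: "0 < \<beta>" using assms(1) by simp
  note summable = torsion_decrement_summable[OF \<beta> c lower upper assms(1)]
  interpret confined_operator "laplacian_dom b" "laplacian b"
    "\<lambda>x. 1 / torsion (level x)" "1 / torsion 0"
    by (rule laplacian_confined_by_torsion[OF summable])
  have "0 < 1 / torsion 0" by (rule c_pos)
  also have "\<dots> \<le> spectral_bottom b"
    unfolding spectral_bottom_def laplacian_spectrum_def by (rule spectral_infimum_pos)
  finally have "0 < spectral_bottom b" .
  moreover have "laplacian_spectrum b = laplacian_discrete_spectrum b"
    unfolding laplacian_spectrum_def laplacian_discrete_spectrum_def by (rule discrete_spectrum)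
  ultimately show ?thesis
    using volume_comparable[OF \<beta> c lower upper] by simp
qed

end
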